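(* Let $X_k$ ($k\in\mathbb{Z}$) be the cluster variables of the generalized quantum cluster algebra of Kronecker type $\mathcal{A}_q(2,2)$, let $X_\delta\in\mathcal{A}_q(2,2)$ be the element $X_\delta=q^{\frac12}X_0X_3-q^{\frac12}(q^{\frac12}X_1+h)(q^{\frac12}X_2+h)$, and let $F_n(x)$ be the Chebyshev polynomials of the first kind (normalized as in the context, in particular $F_0=1$). Let $m$ and $n$ be integers. (1) For any $m>n\geq 1$, $$F_m(X_\delta)F_n(X_\delta)=F_{m+n}(X_\delta)+F_{m-n}(X_\delta),\qquad F_n(X_\delta)F_n(X_\delta)=F_{2n}(X_\delta)+2 .$$ (2) For any $n\geq 1$ (and any $m \in \mathbb{Z}$), $$X_mF_n(X_\delta)=q^{-\frac n2}X_{m-n}+q^{\frac n2}X_{m+n}+\sum_{k=1}^{n}\Big(\sum_{l=1}^{k}q^{-\frac{k+1}{2}+l}\Big)hF_{n-k}(X_\delta).$$ (3) For any $n\geq 2$ (and any $m\in\mathbb{Z}$), $$X_mX_{m+n}=q^{\lfloor\frac n2\rfloor}X_{\lfloor m+\frac n2\rfloor}X_{\lceil m+\frac n2\rceil}+\sum_{k=1}^{n-1}\Big(\sum_{l=1}^{\min(k,n-k)}q^{-\frac12+l}\Big)hX_{m+n-k}+\sum_{l=1}^{n-1}q^{-\frac{n-1-l}{2}}c_lF_{n-1-l}(X_\delta),$$ where $c_1=1$, $c_2=h^2$, and for $k\geq 2$, $$c_{2k}=\Big[\sum_{i=1}^{k-1}a_i\big(q^{-(k-i)}+q^{k-i}\big)+a_k\Big]h^2$$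 and $$c_{2k-1}=2\Big[\sum_{i=1}^{k-1}b_i\big(q^{-(k-i)}+q^{k-i}\big)+b_k\Big]h^2+\begin{cases}\displaystyle\sum_{i=1}^{k/2}\big(q^{-(k+1-2i)}+q^{k+1-2i}\big), & k\text{ even},\\[2mm] \displaystyle\sum_{i=1}^{(k-1)/2}\big(q^{-(k+1-2i)}+q^{k+1-2i}\big)+1, & k\text{ odd},\end{cases}$$ with $a_i=\frac{i(i+1)}{2}$, and $b_i=\frac{i^2-1}{4}$ if $i$ is odd, $b_i=\frac{i^2}{4}$ if $i$ is even.
   Context: Let $q$ be a formal variable, and fix $h\in\mathbb{Z}[q^{\pm\frac12}]$ with $\overline{h}=h$, where the bar on $\mathbb{Z}[q^{\pm\frac12}]$ is the ring involution $q^{\frac12}\mapsto q^{-\frac12}$. Quantum torus: $\mathcal{T}$ is the $\mathbb{Z}[q^{\pm\frac12}]$-algebra with free $\mathbb{Z}[q^{\pm\frac12}]$-basis $\{X(\mathbf a)\mid \mathbf a\in\mathbb{Z}^2\}$ and multiplication $X(\mathbf a)X(\mathbf b)=q^{\frac12\Lambda(\mathbf a,\mathbf b)}X(\mathbf a+\mathbf b)$, where $\Lambda(\mathbf a,\mathbf b)=a_1b_2-a_2b_1$ (elements of $\mathbb{Z}[q^{\pm\frac12}]$ are central). Put $X_1=X(1,0)$, $X_2=X(0,1)$; thus $X_1X_2=qX_2X_1$. Let $\mathcal{F}$ be the skew-field of fractions of $\mathcal{T}$. Cluster variables: the elements $X_k\in\mathcal{F}$ ($k\in\mathbb{Z}$)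 are determined from $X_1,X_2$ by the exchange relations $X_{k-1}X_{k+1}=qX_k^2+q^{\frac12}hX_k+1$ for all $k\in\mathbb{Z}$; by the (known) Laurent phenomenon all $X_k$ lie in $\mathcal{T}$. The algebra $\mathcal{A}_q(2,2)$ is the $\mathbb{Z}[q^{\pm\frac12}]$-subalgebra of $\mathcal{T}$ generated by all $X_k$, $k\in\mathbb{Z}$. (It is the generalized quantum cluster algebra with initial data $\mathbf d=(2,2)$, exchange coefficients $\mathbf h_1=\mathbf h_2=(1,h,1)$, $\Lambda=\begin{pmatrix}0&1\\-1&0\end{pmatrix}$, $B=\begin{pmatrix}0&2\\-2&0\end{pmatrix}$.) Chebyshev polynomials: $F_0(x)=1$, $F_1(x)=x$, $F_2(x)=x^2-2$, $F_{n+1}(x)=F_n(x)x-F_{n-1}(x)$ for $n\geq2$, and $F_n(x)=0$ for $n<0$. $\lfloor\cdot\rfloor$ and $\lceil\cdot\rceil$ are the floor and ceiling functions. *)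

theory Defs
  imports Complex_Main "HOL-Library.Poly_Mapping" "HOL-Library.Product_Plus"
begin

text \<open>
  The group ring of the integers over the integers: the coefficient of a Laurent polynomial
  at the index k is its coefficient at the k-th power of the formal square root of q.
  The multiplication is the convolution product of \<^theory>\<open>HOL-Library.Poly_Mapping\<close>.
\<close>

type_synonym laurent = "int \<Rightarrow>\<^sub>0 int"

text \<open>\<open>qh k\<close> is q to the power k/2. In particular \<open>qh 1\<close> is the square root of q and
  \<open>qh 2\<close> is q itself.\<close>

definition qh :: "int \<Rightarrow> laurent" where
  "qh k = Poly_Mapping.single k 1"

definition bar :: "laurent \<Rightarrow> laurent" where
  "bar p = Poly_Mapping.map_key uminus p"

lemma qh_0: "qh 0 = 1"
  by (simp add: qh_def)

lemma qh_add: "qh (k + l) = qh k * qh l"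
  by (simp add: qh_def mult_single)

lemma lookup_bar: "Poly_Mapping.lookup (bar p) k = Poly_Mapping.lookup p (- k)"
  by (simp add: bar_def map_key.rep_eq)

lemma bar_qh: "bar (qh k) = qh (- k)"
  by (rule poly_mapping_eqI) (auto simp: lookup_bar qh_def lookup_single when_def)

definition Lam :: "int \<times> int \<Rightarrow> int \<times> int \<Rightarrow> int" where
  "Lam a b = fst a * snd b - snd a * fst b"

text \<open>Bilinear extension of the twisted product of the basis elements. The untwisted
  convolution product on the same type plays no role.\<close>

definition qmul :: "((int \<times> int) \<Rightarrow>\<^sub>0 laurent) \<Rightarrow> ((int \<times> int) \<Rightarrow>\<^sub>0 laurent)
    \<Rightarrow> ((int \<times> int) \<Rightarrow>\<^sub>0 laurent)" where
  "qmul f g = (\<Sum>a\<in>Poly_Mapping.keys f. \<Sum>b\<in>Poly_Mapping.keys g.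
     Poly_Mapping.single (a + b)
       (qh (Lam a b) * Poly_Mapping.lookup f a * Poly_Mapping.lookup g b))"

lemma qmul_superset:
  assumes "finite A" "Poly_Mapping.keys f \<subseteq> A" "finite B" "Poly_Mapping.keys g \<subseteq> B"
  shows "qmul f g = (\<Sum>a\<in>A. \<Sum>b\<in>B. Poly_Mapping.single (a + b)
     (qh (Lam a b) * Poly_Mapping.lookup f a * Poly_Mapping.lookup g b))"
proof -
  have "qmul f g = (\<Sum>a\<in>Poly_Mapping.keys f. \<Sum>b\<in>B. Poly_Mapping.single (a + b)
     (qh (Lam a b) * Poly_Mapping.lookup f a * Poly_Mapping.lookup g b))"
    unfolding qmul_def using assms
    by (intro sum.cong refl sum.mono_neutral_left) (auto simp: in_keys_iff)
  also have "\<dots> = (\<Sum>a\<in>A. \<Sum>b\<in>B. Poly_Mapping.single (a + b)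
     (qh (Lam a b) * Poly_Mapping.lookup f a * Poly_Mapping.lookup g b))"
    using assms by (intro sum.mono_neutral_left) (auto simp: in_keys_iff)
  finally show ?thesis .
qed

lemma qmul_add_left: "qmul (f + g) k = qmul f k + qmul g k"
proof -
  define A where "A = Poly_Mapping.keys f \<union> Poly_Mapping.keys g"
  have A: "finite A" "Poly_Mapping.keys f \<subseteq> A" "Poly_Mapping.keys g \<subseteq> A"
    "Poly_Mapping.keys (f + g) \<subseteq> A"
    using keys_add[of f g] by (auto simp: A_def)
  note S = qmul_superset[OF A(1) _ finite_keys order_refl]
  show ?thesis
    by (simp add: S[OF A(2)] S[OF A(3)] S[OF A(4)] lookup_add algebra_simps single_add
        sum.distrib)
qed

lemma qmul_add_right: "qmul k (f + g) = qmul k f + qmul k g"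
proof -
  define A where "A = Poly_Mapping.keys f \<union> Poly_Mapping.keys g"
  have A: "finite A" "Poly_Mapping.keys f \<subseteq> A" "Poly_Mapping.keys g \<subseteq> A"
    "Poly_Mapping.keys (f + g) \<subseteq> A"
    using keys_add[of f g] by (auto simp: A_def)
  note S = qmul_superset[OF finite_keys order_refl A(1)]
  show ?thesis
    by (simp add: S[OF A(2)] S[OF A(3)] S[OF A(4)] lookup_add algebra_simps single_add
        sum.distrib)
qed

lemma qmul_single:
  "qmul (Poly_Mapping.single a x) (Poly_Mapping.single b y)
     = Poly_Mapping.single (a + b) (qh (Lam a b) * x * y)"
  by (subst qmul_superset[of "{a}" _ "{b}"]) auto

lemma qmul_0_left: "qmul 0 f = 0" and qmul_0_right: "qmul f 0 = 0"
  by (simp_all add: qmul_def)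

lemma additive_induct:
  fixes f :: "'a \<Rightarrow>\<^sub>0 'b::comm_monoid_add"
  assumes "\<And>a x. P (Poly_Mapping.single a x)" "\<And>f g. P f \<Longrightarrow> P g \<Longrightarrow> P (f + g)"
  shows "P f"
proof -
  have P0: "P 0" using assms(1)[of undefined 0] by simp
  have "P (\<Sum>a\<in>A. Poly_Mapping.single a (Poly_Mapping.lookup f a))" if "finite A" for A
    using that by induction (auto intro: P0 assms)
  moreover have "f = (\<Sum>a\<in>Poly_Mapping.keys f. Poly_Mapping.single a (Poly_Mapping.lookup f a))"
    by (rule poly_mapping_eqI) (auto simp: lookup_sum lookup_single when_def in_keys_iff)
  ultimately show ?thesis by (metis finite_keys)
qed

lemma qmul_assoc: "qmul (qmul f g) k = qmul f (qmul g k)"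
proof (induction f rule: additive_induct)
  case (1 a x)
  show ?case
  proof (induction g rule: additive_induct)
    case (1 b y)
    show ?case
    proof (induction k rule: additive_induct)
      case (1 c z)
      have "qh (Lam (a + b) c) * (qh (Lam a b) * x * y) * z
          = qh (Lam (a + b) c + Lam a b) * (x * y * z)"
        by (simp only: qh_add mult.assoc)
      also have "Lam (a + b) c + Lam a b = Lam a (b + c) + Lam b c"
        by (simp add: Lam_def algebra_simps)
      also have "qh (Lam a (b + c) + Lam b c) * (x * y * z)
          = qh (Lam a (b + c)) * x * (qh (Lam b c) * y * z)"
        by (simp only: qh_add mult_ac)
      finally show ?case
        by (simp only: qmul_single add.assoc)
    qed (simp add: qmul_add_right)
  qed (simp add: qmul_add_right qmul_add_left)
qed (simp add: qmul_add_left)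

lemma qmul_1_left: "qmul (Poly_Mapping.single 0 1) f = f"
  by (induction f rule: additive_induct)
    (simp_all add: qmul_single qmul_add_right Lam_def qh_0 del: single_one)

lemma qmul_1_right: "qmul f (Poly_Mapping.single 0 1) = f"
  by (induction f rule: additive_induct)
    (simp_all add: qmul_single qmul_add_left Lam_def qh_0 del: single_one)

typedef qtorus = "UNIV :: ((int \<times> int) \<Rightarrow>\<^sub>0 laurent) set"
  morphisms coeffs of_coeffs ..

setup_lifting type_definition_qtorus

instantiation qtorus :: ring_1
begin

lift_definition zero_qtorus :: qtorus is 0 .
lift_definition one_qtorus :: qtorus is "Poly_Mapping.single 0 1" .
lift_definition plus_qtorus :: "qtorus \<Rightarrow> qtorus \<Rightarrow> qtorus" is "(+)" .
lift_definition minus_qtorus :: "qtorus \<Rightarrow> qtorus \<Rightarrow> qtorus" is "(-)" .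
lift_definition uminus_qtorus :: "qtorus \<Rightarrow> qtorus" is uminus .
lift_definition times_qtorus :: "qtorus \<Rightarrow> qtorus \<Rightarrow> qtorus" is qmul .

instance
proof
  show "(0::qtorus) \<noteq> 1"
    by transfer (metis lookup_single_eq lookup_zero zero_neq_one)
  fix a b c :: qtorus
  show "a * b * c = a * (b * c)" by transfer (rule qmul_assoc)
  show "1 * a = a" by transfer (rule qmul_1_left)
  show "a * 1 = a" by transfer (rule qmul_1_right)
  show "(a + b) * c = a * c + b * c" by transfer (rule qmul_add_left)
  show "a * (b + c) = a * b + a * c" by transfer (rule qmul_add_right)
  show "a + b + c = a + (b + c)" by transfer (rule add.assoc)
  show "a + b = b + a" by transfer (rule add.commute)
  show "0 + a = a" by transfer (rule add_0_left)
  show "- a + a = 0" by transfer (rule left_minus)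
  show "a - b = a + - b" by transfer (rule diff_conv_add_uminus)
qed

end

definition qX :: "int \<times> int \<Rightarrow> qtorus" where
  "qX a = of_coeffs (Poly_Mapping.single a 1)"

text \<open>The structure map of the algebra: its image consists of the multiples of
  \<open>qX (0, 0) = 1\<close>.\<close>

definition scalar :: "laurent \<Rightarrow> qtorus" where
  "scalar p = of_coeffs (Poly_Mapping.single (0, 0) p)"

lemma of_coeffs_mult: "of_coeffs f * of_coeffs g = of_coeffs (qmul f g)"
  by (simp add: times_qtorus_def of_coeffs_inverse)

lemma of_coeffs_add: "of_coeffs f + of_coeffs g = of_coeffs (f + g)"
  by (simp add: plus_qtorus_def of_coeffs_inverse)

lemma qX_0: "qX (0, 0) = 1"
  by (simp add: qX_def one_qtorus_def zero_prod_def)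

lemma qX_mult: "qX a * qX b = scalar (qh (Lam a b)) * qX (a + b)"
  by (simp add: qX_def scalar_def of_coeffs_mult qmul_single Lam_def qh_0 flip: zero_prod_def)

lemma qX_1_2: "qX (1, 0) * qX (0, 1) = scalar (qh 2) * (qX (0, 1) * qX (1, 0))"
  by (simp add: qX_def scalar_def of_coeffs_mult qmul_single Lam_def qh_0 flip: qh_add)

lemma scalar_1: "scalar 1 = 1"
  by (simp add: scalar_def one_qtorus_def zero_prod_def)

lemma scalar_add: "scalar (p + r) = scalar p + scalar r"
  by (simp add: scalar_def of_coeffs_add single_add)

lemma scalar_mult: "scalar (p * r) = scalar p * scalar r"
  by (simp add: scalar_def of_coeffs_mult qmul_single Lam_def qh_0)

lemma scalar_central: "scalar p * x = x * scalar p"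
proof -
  have "qmul (Poly_Mapping.single (0, 0) p) f = qmul f (Poly_Mapping.single (0, 0) p)" for f
    by (induction f rule: additive_induct)
      (simp_all add: qmul_single qmul_add_left qmul_add_right Lam_def qh_0 mult_ac
        flip: zero_prod_def)
  then show ?thesis
    by (metis coeffs_inverse of_coeffs_mult scalar_def)
qed

text \<open>The \<open>qX a\<close> form a basis: the coordinates of an element are given by \<open>coeffs\<close>, and
  every finitely supported family of coordinates occurs.\<close>

lemma qtorus_expansion:
  "x = (\<Sum>a\<in>Poly_Mapping.keys (coeffs x). scalar (Poly_Mapping.lookup (coeffs x) a) * qX a)"
proof -
  have "of_coeffs (\<Sum>a\<in>A. Poly_Mapping.single a (p a)) = (\<Sum>a\<in>A. scalar (p a) * qX a)"
    if "finite A" for A p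
    using that
    by induction
      (simp_all add: scalar_def qX_def of_coeffs_mult qmul_single Lam_def qh_0
        zero_qtorus_def flip: zero_prod_def of_coeffs_add)
  moreover have "coeffs x = (\<Sum>a\<in>Poly_Mapping.keys (coeffs x).
      Poly_Mapping.single a (Poly_Mapping.lookup (coeffs x) a))"
    by (rule poly_mapping_eqI) (auto simp: lookup_sum lookup_single when_def in_keys_iff)
  ultimately show ?thesis
    by (metis coeffs_inverse finite_keys)
qed

text \<open>
  \<open>skew_field_of_fractions \<iota>\<close>: the codomain is a skew-field of fractions of the quantum torus
  via the embedding \<open>\<iota>\<close>, i.e. \<open>\<iota>\<close> is an injective homomorphism of unital rings
  and every element of the codomain is a right fraction of elements of the image. Since the quantum
  torus is a (two-sided) Ore domain, such an embedding exists and is unique up to a unique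
  isomorphism.
\<close>

definition skew_field_of_fractions :: "(qtorus \<Rightarrow> 'f::division_ring) \<Rightarrow> bool" where
  "skew_field_of_fractions \<iota> \<longleftrightarrow>
     \<iota> 1 = 1 \<and>
     (\<forall>x y. \<iota> (x + y) = \<iota> x + \<iota> y) \<and>
     (\<forall>x y. \<iota> (x * y) = \<iota> x * \<iota> y) \<and>
     inj \<iota> \<and>
     (\<forall>z. \<exists>x y. y \<noteq> 0 \<and> z = \<iota> x * inverse (\<iota> y))"

definition sc :: "(qtorus \<Rightarrow> 'f::division_ring) \<Rightarrow> laurent \<Rightarrow> 'f" where
  "sc \<iota> p = \<iota> (scalar p)"

text \<open>The exchange relations for all integers k determine the whole family from \<open>X 1\<close> and
  \<open>X 2\<close>: in a skew-field of fractions there is exactly one such family, and by the Laurent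
  phenomenon its members lie in the image of \<open>\<iota>\<close>.\<close>

definition cluster_variables ::
    "(qtorus \<Rightarrow> 'f::division_ring) \<Rightarrow> laurent \<Rightarrow> (int \<Rightarrow> 'f) \<Rightarrow> bool" where
  "cluster_variables \<iota> h X \<longleftrightarrow>
     X 1 = \<iota> (qX (1, 0)) \<and>
     X 2 = \<iota> (qX (0, 1)) \<and>
     (\<forall>k. X (k - 1) * X (k + 1) = sc \<iota> (qh 2) * (X k)^2 + sc \<iota> (qh 1 * h) * X k + 1)"

text \<open>Closure under subtraction is not listed: it follows, as -1 is a scalar.\<close>

inductive_set cluster_algebra :: "(qtorus \<Rightarrow> 'f::division_ring) \<Rightarrow> (int \<Rightarrow> 'f) \<Rightarrow> 'f set"
  for \<iota> X where
  variable: "X k \<in> cluster_algebra \<iota> X"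
| scalars: "sc \<iota> p \<in> cluster_algebra \<iota> X"
| add: "x \<in> cluster_algebra \<iota> X \<Longrightarrow> y \<in> cluster_algebra \<iota> X \<Longrightarrow> x + y \<in> cluster_algebra \<iota> X"
| mult: "x \<in> cluster_algebra \<iota> X \<Longrightarrow> y \<in> cluster_algebra \<iota> X \<Longrightarrow> x * y \<in> cluster_algebra \<iota> X"

definition X_delta :: "(qtorus \<Rightarrow> 'f::division_ring) \<Rightarrow> laurent \<Rightarrow> (int \<Rightarrow> 'f) \<Rightarrow> 'f" where
  "X_delta \<iota> h X =
     sc \<iota> (qh 1) * X 0 * X 3
     - sc \<iota> (qh 1) * (sc \<iota> (qh 1) * X 1 + sc \<iota> h) * (sc \<iota> (qh 1) * X 2 + sc \<iota> h)"

lemma X_delta_in_cluster_algebra: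
  assumes "skew_field_of_fractions \<iota>"
  shows "X_delta \<iota> h X \<in> cluster_algebra \<iota> X"
proof -
  have a: "\<iota> (x + y) = \<iota> x + \<iota> y" and o: "\<iota> 1 = 1" for x y
    using assms by (auto simp: skew_field_of_fractions_def)
  have "\<iota> 0 + \<iota> 0 = \<iota> 0" using a[of 0 0] by simp
  then have z: "\<iota> 0 = 0" by simp
  have "\<iota> (- 1) + 1 = 0" using a[of "- 1" 1] by (simp add: z o)
  then have "\<iota> (- 1) = - 1" by (simp add: eq_neg_iff_add_eq_0)
  moreover have "scalar (- 1) = - 1"
    using scalar_add[of "- 1" 1] scalar_add[of 0 0]
    by (simp add: scalar_1 eq_neg_iff_add_eq_0)
  ultimately have m1: "sc \<iota> (- 1) = - 1"
    by (simp add: sc_def)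
  have "X_delta \<iota> h X = sc \<iota> (qh 1) * X 0 * X 3 + sc \<iota> (- 1) *
      (sc \<iota> (qh 1) * (sc \<iota> (qh 1) * X 1 + sc \<iota> h) * (sc \<iota> (qh 1) * X 2 + sc \<iota> h))"
    by (simp add: X_delta_def m1)
  also have "\<dots> \<in> cluster_algebra \<iota> X"
    by (intro cluster_algebra.intros)
  finally show ?thesis .
qed

text \<open>The value of the n-th polynomial at an element of a unital ring. The polynomials
  have integer coefficients, and evaluation at a fixed element is a ring homomorphism, so that the
  recursion can be carried out on the values, even in a noncommutative ring.\<close>

fun cheb_nat :: "nat \<Rightarrow> 'a::ring_1 \<Rightarrow> 'a" where
  "cheb_nat 0 x = 1"
| "cheb_nat (Suc 0) x = x"
| "cheb_nat (Suc (Suc 0)) x = x^2 - 2"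
| "cheb_nat (Suc (Suc (Suc n))) x = cheb_nat (Suc (Suc n)) x * x - cheb_nat (Suc n) x"

definition cheb :: "int \<Rightarrow> 'a::ring_1 \<Rightarrow> 'a" where
  "cheb n x = (if n < 0 then 0 else cheb_nat (nat n) x)"

text \<open>All the integer divisions below are exact.\<close>

definition coef_a :: "int \<Rightarrow> int" where
  "coef_a i = i * (i + 1) div 2"

definition coef_b :: "int \<Rightarrow> int" where
  "coef_b i = (if odd i then (i^2 - 1) div 4 else i^2 div 4)"

definition coef_even :: "laurent \<Rightarrow> int \<Rightarrow> laurent" where
  "coef_even h k =
     ((\<Sum>i=1..k-1. of_int (coef_a i) * (qh (- 2 * (k - i)) + qh (2 * (k - i))))
       + of_int (coef_a k)) * h^2"

definition coef_odd :: "laurent \<Rightarrow> int \<Rightarrow> laurent" where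
  "coef_odd h k =
     2 * ((\<Sum>i=1..k-1. of_int (coef_b i) * (qh (- 2 * (k - i)) + qh (2 * (k - i))))
       + of_int (coef_b k)) * h^2
     + (if even k
        then (\<Sum>i=1..k div 2. qh (- 2 * (k + 1 - 2 * i)) + qh (2 * (k + 1 - 2 * i)))
        else (\<Sum>i=1..(k - 1) div 2. qh (- 2 * (k + 1 - 2 * i)) + qh (2 * (k + 1 - 2 * i))) + 1)"

text \<open>Only indices \<open>l \<ge> 1\<close> are meaningful; for \<open>l \<ge> 3\<close> one has \<open>l = 2 * k\<close>
  or \<open>l = 2 * k - 1\<close> with \<open>k \<ge> 2\<close>.\<close>

definition coef_c :: "laurent \<Rightarrow> int \<Rightarrow> laurent" where
  "coef_c h l =
     (if l = 1 then 1
      else if l = 2 then h^2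
      else if even l then coef_even h (l div 2)
      else coef_odd h ((l + 1) div 2))"

end

theory Submission
  imports Defs
begin

text \<open>
  Write \<open>v\<close> for the square root of \<open>q\<close>. Neighbouring cluster variables q-commute, and consequently
  \<open>X\<^sub>k X\<^sub>\<delta> = v\<^sup>-\<^sup>1 X\<^sub>k\<^sub>-\<^sub>1 + v X\<^sub>k\<^sub>+\<^sub>1 + h\<close> for all \<open>k\<close>: the element \<open>X\<^sub>\<delta>\<close> does not depend on the pair of
  neighbours that is used to define it. With the Chebyshev recursion this gives (2) by induction
  on \<open>n\<close>. Read as a formula for \<open>X\<^sub>k\<^sub>+\<^sub>1\<close>, it expresses \<open>X\<^sub>m X\<^sub>m\<^sub>+\<^sub>n\<^sub>+\<^sub>1\<close> by \<open>X\<^sub>m X\<^sub>m\<^sub>+\<^sub>n\<close> and \<open>X\<^sub>m X\<^sub>m\<^sub>+\<^sub>n\<^sub>-\<^sub>1\<close>,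
  and (3) follows by induction on \<open>n\<close>, where collecting the constant terms amounts to
  \<open>c\<^sub>n = q\<^sup>-\<^sup>1 c\<^sub>n\<^sub>-\<^sub>2 + v\<^sup>-\<^sup>1 h\<^sup>2 T\<^sub>n\<close>, plus \<open>v\<^sup>n\<^sup>-\<^sup>1\<close> if \<open>n\<close> is odd; here \<open>h T\<^sub>n\<close> is the sum of the
  coefficients in the middle sum of (3).
\<close>

section \<open>Chebyshev polynomials\<close>

lemma cheb_0 [simp]: "cheb 0 x = 1" and cheb_neg: "n < 0 \<Longrightarrow> cheb n x = 0"
  by (simp_all add: cheb_def)

text \<open>The recursion holds uniformly up to two corrections, which come from \<open>F\<^sub>0 = 1\<close> in place of 2
  and from \<open>F\<^sub>-\<^sub>1 = 0\<close>.\<close>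

lemma cheb_mult_arg:
  fixes x :: "'a::ring_1"
  shows "cheb j x * x = cheb (j + 1) x + cheb (j - 1) x + of_bool (j = 1) - of_bool (j = - 1)"
proof -
  consider "j < - 1" | "j = - 1" | "j = 0" | "j = 1" | "j \<ge> 2" by linarith
  then show ?thesis
  proof cases
    case 4
    have "cheb_nat 2 x = x * x - 2"
      by (metis cheb_nat.simps(3) numeral_2_eq_2 power2_eq_square)
    with 4 show ?thesis by (simp add: cheb_def)
  next
    case 5
    then obtain n where "j - 2 = int n" using zero_le_imp_eq_int[of "j - 2"] by auto
    then have "nat (j + 1) = Suc (Suc (Suc n))" "nat (j - 1) = Suc n" "nat j = Suc (Suc n)"
      by linarith+
    then show ?thesis using 5 by (simp add: cheb_def)
  qed (simp_all add: cheb_def)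
qed

text \<open>With the value 2 at 0 the three-term recursion holds from the start.\<close>

definition cheb_G :: "int \<Rightarrow> 'a::ring_1 \<Rightarrow> 'a" where
  "cheb_G n x = (if n = 0 then 2 else cheb n x)"

lemma cheb_G_step:
  fixes x :: "'a::ring_1"
  assumes "n \<ge> 0"
  shows "cheb_G (n + 2) x = cheb_G (n + 1) x * x - cheb_G n x"
  using assms cheb_mult_arg[of "n + 1" x] by (auto simp: cheb_G_def add.assoc)

lemma int_two_step_induct [consumes 1, case_names 0 1 step]:
  fixes n :: int
  assumes "n \<ge> 0" "Q 0" "Q 1" "\<And>n. n \<ge> 1 \<Longrightarrow> Q (n - 1) \<Longrightarrow> Q n \<Longrightarrow> Q (n + 1)"
  shows "Q n"
proof -
  have "Q n \<and> Q (n + 1)"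
    using assms(1)
  proof (induction n rule: int_ge_induct)
    case (step i)
    then show ?case using assms(4)[of "i + 1"] by simp
  qed (simp_all add: assms)
  then show ?thesis by blast
qed

text \<open>At \<open>x = t + 1/t\<close> this is the product rule for \<open>t^n + t^-n\<close>.
  With m fixed, both sides obey the same recursion in n; the bound by m keeps the index m - n - 1,
  at which the step uses that recursion, nonnegative.\<close>

lemma cheb_G_mult:
  fixes x :: "'a::ring_1"
  assumes "n \<ge> 0" "n \<le> m"
  shows "cheb_G m x * cheb_G n x = cheb_G (m + n) x + cheb_G (m - n) x"
  using assms
proof (induction n rule: int_two_step_induct)
  case 0
  then show ?case by (simp add: cheb_G_def mult_2_right)
next
  case 1
  then show ?case
    using cheb_G_step[of "m - 1" x]
    by (simp add: cheb_G_def[of 1] cheb_def[of 1] algebra_simps)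
next
  case (step n)
  have "cheb_G m x * cheb_G (n + 1) x
      = (cheb_G m x * cheb_G n x) * x - cheb_G m x * cheb_G (n - 1) x"
  proof -
    have "cheb_G (n + 1) x = cheb_G n x * x - cheb_G (n - 1) x"
      using cheb_G_step[of "n - 1" x] step.hyps by (simp add: add.commute)
    then show ?thesis by (simp add: right_diff_distrib mult.assoc)
  qed
  also have "\<dots> = (cheb_G (m + n) x * x - cheb_G (m + n - 1) x)
      + (cheb_G (m - n) x * x - cheb_G (m - n + 1) x)"
    using step by (simp add: algebra_simps)
  also have "cheb_G (m + n) x * x - cheb_G (m + n - 1) x = cheb_G (m + (n + 1)) x"
    using cheb_G_step[of "m + n - 1" x] step by (simp add: algebra_simps)
  also have "cheb_G (m - n) x * x - cheb_G (m - n + 1) x = cheb_G (m - (n + 1)) x"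
    using cheb_G_step[of "m - n - 1" x] step by (simp add: algebra_simps)
  finally show ?case .
qed

lemma cheb_mult:
  assumes "n \<ge> 1" "m > n"
  shows "cheb m x * cheb n x = cheb (m + n) x + cheb (m - n) x"
  using cheb_G_mult[of n m x] assms by (simp add: cheb_G_def)

lemma cheb_square:
  assumes "n \<ge> 1"
  shows "cheb n x * cheb n x = cheb (2 * n) x + 2"
  using cheb_G_mult[of n n x] assms by (simp add: cheb_G_def)

section \<open>Coefficients\<close>

text \<open>A finitely supported summand tolerates any window that covers its support. This brings
  sums with shifted indices to a common range, where they can be compared termwise.\<close>

lemma sum_shift_int:
  fixes a b c e d :: int
  assumes "\<And>i. i \<notin> {a..b} \<Longrightarrow> f i = 0" "c + d \<le> a" "b \<le> e + d"
  shows "(\<Sum>i=c..e. f (i + d)) = sum f {a..b}"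
proof -
  have "(\<Sum>i=c..e. f (i + d)) = sum f {c+d..e+d}"
    by (rule sum.reindex_bij_witness[of _ "\<lambda>i. i - d" "\<lambda>i. i + d"]) auto
  also have "\<dots> = sum f {a..b}"
    using assms by (intro sum.mono_neutral_right) auto
  finally show ?thesis .
qed

lemma sum_int_last:
  fixes a b :: int
  assumes "a \<le> b + 1"
  shows "sum f {a..b + 1} = sum f {a..b} + f (b + 1)"
proof -
  have "{a..b + 1} = insert (b + 1) {a..b}" using assms by auto
  then show ?thesis by (simp add: add.commute)
qed

lemma sum_int_first:
  fixes a b :: int
  assumes "a \<le> b"
  shows "sum f {a..b} = f a + sum f {a + 1..b}"
proof -
  have "{a..b} = insert a {a + 1..b}" using assms by auto
  then show ?thesis by simp
qed

section \<open>Symmetric quantum integers \<open>v^(1-k) + ... + v^(k-1)\<close>\<close>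

definition qint :: "int \<Rightarrow> laurent" where
  "qint k = (\<Sum>l=1..k. qh (- (k + 1) + 2 * l))"

lemma qint_step:
  assumes "n \<ge> 1"
  shows "qint (n + 1) = qint (n - 1) + qh n + qh (- n)"
proof -
  have "qint (n + 1) = qh (- n) + (\<Sum>l=1+1..n. qh (- (n + 2) + 2 * l)) + qh n"
    using assms by (simp add: qint_def sum_int_last sum_int_first[of 1 n] add.assoc)
  also have "(\<Sum>l=1+1..n. qh (- (n + 2) + 2 * l)) = qint (n - 1)"
    unfolding qint_def
    by (rule sum.reindex_bij_witness[of _ "\<lambda>i. i + 1" "\<lambda>i. i - 1"]) (auto simp: algebra_simps)
  finally show ?thesis by simp
qed

section \<open>The sums \<open>v * (1 + q + ... + q^(k-1))\<close> and the coefficients of the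
  linear part\<close>

definition qodd :: "int \<Rightarrow> laurent" where
  "qodd k = (\<Sum>l=1..k. qh (- 1 + 2 * l))"

lemma qodd_nonpos: "k \<le> 0 \<Longrightarrow> qodd k = 0"
  by (simp add: qodd_def)

lemma qodd_Suc: "k \<ge> 0 \<Longrightarrow> qodd (k + 1) = qodd k + qh (2 * k + 1)"
  unfolding qodd_def
  by (subst sum_int_last) (auto simp: algebra_simps)

lemma qodd_Suc_left: "k \<ge> 0 \<Longrightarrow> qodd (k + 1) = qh 1 + qh 2 * qodd k"
proof (induction k rule: int_ge_induct)
  case base
  then show ?case by (simp add: qodd_def)
next
  case (step i)
  have "qodd (i + 1 + 1) = qodd (i + 1) + qh (2 * (i + 1) + 1)"
    using step by (simp only: qodd_Suc)
  also have "\<dots> = qh 1 + qh 2 * (qodd i + qh (2 * i + 1))"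
    using step by (simp add: distrib_left flip: qh_add)
  finally show ?case using step by (simp add: qodd_Suc)
qed

text \<open>The coefficient of \<open>X (m + j)\<close> in \<open>X m * X (m + n)\<close> is \<open>X_coef n j * h\<close>. It is symmetric
  under exchanging j and n - j, and vanishes outside of 1..n-1.\<close>

definition X_coef :: "int \<Rightarrow> int \<Rightarrow> laurent" where
  "X_coef n j = qodd (min j (n - j))"

lemma X_coef_outside: "j \<notin> {1..n - 1} \<Longrightarrow> X_coef n j = 0"
  by (auto simp: X_coef_def intro!: qodd_nonpos)

text \<open>The last two summands come from the leading term of \<open>X m * X (m + n)\<close>.\<close>

lemma X_coef_step:
  assumes "n \<ge> 1" "0 \<le> j" "j \<le> n"
  shows "X_coef (n + 1) j + of_bool (j = 0) * qh (- 1) + qh (- 2) * X_coef (n - 1) j =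
    qh (- 2) * X_coef n (j + 1) + X_coef n (j - 1)
     + of_bool (j = n div 2) * qh (2 * (n div 2) - 1)
     + of_bool (odd n \<and> j = (n + 1) div 2) * qh n"
proof -
  have low: "qh (- 2) * qodd (j + 1) + qodd (j - 1) = qodd j + qh (- 2) * qodd j" if "j \<ge> 1"
    using qodd_Suc[of j] qodd_Suc[of "j - 1"] that by (simp add: distrib_left flip: qh_add)
  \<comment> \<open>The branch taken by the minimum in \<open>X_coef\<close> depends on the position
    of 2j relative to n; near the middle the four coefficients take different branches.\<close>
  consider "j = 0" | "j \<ge> 1" "2 * j \<le> n - 2" | "j \<ge> 1" "2 * j = n - 1" | "j \<ge> 1" "2 * j = n"
    | "j \<ge> 1" "2 * j = n + 1" | "j \<ge> 1" "2 * j \<ge> n + 2"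
    using assms by linarith
  then show ?thesis
  proof cases
    case 1
    then have "X_coef (n + 1) j = 0" "X_coef (n - 1) j = 0" "X_coef n (j - 1) = 0"
      by (simp_all add: X_coef_outside)
    \<comment> \<open>At the left end \<open>qh (- 1)\<close> is supplied by
      \<open>X_coef n 1\<close> if n > 1, and by the leading term if n = 1.\<close>
    moreover have "X_coef n (j + 1) = of_bool (n \<noteq> 1) * qh 1"
      using assms 1 by (auto simp: X_coef_def qodd_def min_def)
    moreover have "j = n div 2 \<longleftrightarrow> n = 1" "j \<noteq> (n + 1) div 2" "n = 1 \<Longrightarrow> n div 2 = 0"
      using assms 1 by auto
    ultimately show ?thesis using 1 by (auto simp flip: qh_add)
  next
    case 2
    then have t: "X_coef (n + 1) j = qodd j" "X_coef (n - 1) j = qodd j"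
      "X_coef n (j + 1) = qodd (j + 1)" "X_coef n (j - 1) = qodd (j - 1)"
      by (auto simp: X_coef_def min_def intro!: arg_cong[where f = qodd])
    have "j \<noteq> 0" "n div 2 \<noteq> j" "(n + 1) div 2 \<noteq> j" using 2 by auto
    then show ?thesis using low[OF 2(1)] by (simp add: t)
  next
    case 3
    then have t: "X_coef (n + 1) j = qodd j" "X_coef (n - 1) j = qodd j"
      "X_coef n (j + 1) = qodd j" "X_coef n (j - 1) = qodd (j - 1)"
      by (auto simp: X_coef_def min_def intro!: arg_cong[where f = qodd])
    have "j \<noteq> 0" "n div 2 = j" "(n + 1) div 2 \<noteq> j" using 3 by auto
    then show ?thesis using qodd_Suc[of "j - 1"] 3(1) by (simp add: t)
  next
    case 4
    then have t: "X_coef (n + 1) j = qodd j" "X_coef (n - 1) j = qodd (j - 1)"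
      "X_coef n (j + 1) = qodd (j - 1)" "X_coef n (j - 1) = qodd (j - 1)"
      by (auto simp: X_coef_def min_def intro!: arg_cong[where f = qodd])
    have "j \<noteq> 0" "n div 2 = j" "even n" using 4 by auto
    then show ?thesis using qodd_Suc[of "j - 1"] 4(1) by (simp add: t)
  next
    case 5
    then have t: "X_coef (n + 1) j = qodd j" "X_coef (n - 1) j = qodd (j - 2)"
      "X_coef n (j + 1) = qodd (j - 2)" "X_coef n (j - 1) = qodd (j - 1)"
      by (auto simp: X_coef_def min_def intro!: arg_cong[where f = qodd])
    have n: "n = 2 * j - 1" using 5 by simp
    have "j \<noteq> 0" "n div 2 \<noteq> j" "odd n" "(n + 1) div 2 = j" using 5 unfolding n by auto
    then show ?thesis using qodd_Suc[of "j - 1"] 5(1) by (simp add: t) (simp add: n)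
  next
    case 6
    then have t: "X_coef (n + 1) j = qodd (n + 1 - j)" "X_coef (n - 1) j = qodd (n - 1 - j)"
      "X_coef n (j + 1) = qodd (n - 1 - j)" "X_coef n (j - 1) = qodd (n + 1 - j)"
      by (auto simp: X_coef_def min_def intro!: arg_cong[where f = qodd])
    have "j \<noteq> 0" "n div 2 \<noteq> j" "(n + 1) div 2 \<noteq> j" using 6 by auto
    then show ?thesis by (simp add: t)
  qed
qed

text \<open>This is the quantity T of the overview.\<close>

definition X_coef_sum :: "int \<Rightarrow> laurent" where
  "X_coef_sum n = (\<Sum>j=1..n - 1. X_coef n j)"

text \<open>Replacing n by n + 2 and j by j + 1 raises the minimum in \<open>X_coef\<close> by one,
  which multiplies a coefficient by q and adds v. The range 0..n contributes n + 1 such summands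
  v.\<close>

lemma X_coef_sum_step:
  assumes "n \<ge> 0"
  shows "X_coef_sum (n + 2) = qh 2 * X_coef_sum n + of_int (n + 1) * qh 1"
proof -
  have "X_coef_sum (n + 2) = (\<Sum>j=0..n. X_coef (n + 2) (j + 1))"
    unfolding X_coef_sum_def by (rule sum_shift_int[symmetric]) (auto intro: X_coef_outside)
  also have "\<dots> = (\<Sum>j=0..n. qh 1 + qh 2 * X_coef n j)"
  proof (rule sum.cong[OF refl])
    fix j assume "j \<in> {0..n}"
    then show "X_coef (n + 2) (j + 1) = qh 1 + qh 2 * X_coef n j"
    proof -
      have "min (j + 1) (n + 2 - (j + 1)) = min j (n - j) + 1" by auto
      then show ?thesis
        using qodd_Suc_left[of "min j (n - j)"] \<open>j \<in> {0..n}\<close> unfolding X_coef_def by simp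
    qed
  qed
  also have "\<dots> = of_int (n + 1) * qh 1 + qh 2 * (\<Sum>j=0..n. X_coef n j)"
    using assms by (simp add: sum.distrib sum_distrib_left)
  also have "(\<Sum>j=0..n. X_coef n j) = X_coef_sum n"
    unfolding X_coef_sum_def using sum_shift_int[of 1 "n - 1" "X_coef n" 0 0 n]
    by (simp add: X_coef_outside)
  finally show ?thesis by simp
qed

section \<open>Recursions for the constants in (3)\<close>

definition symmetric_sum :: "(int \<Rightarrow> int) \<Rightarrow> int \<Rightarrow> laurent" where
  "symmetric_sum a k =
     (\<Sum>i=1..k-1. of_int (a i) * (qh (- 2 * (k - i)) + qh (2 * (k - i)))) + of_int (a k)"

text \<open>Multiplication by \<open>qh (- 2)\<close> moves the negative powers into place, but
  leaves the positive ones displaced by two indices. This produces the differences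
  \<open>a i - a (i - 2)\<close>; the zeros of a at 0 and -1 allow the range to start at 1.\<close>

lemma symmetric_sum_step:
  assumes "a 0 = 0" "a (- 1) = 0" "k \<ge> 0"
  shows "symmetric_sum a (k + 1) =
    qh (- 2) * symmetric_sum a k + (\<Sum>i=1..k+1. of_int (a i - a (i - 2)) * qh (2 * (k + 1 - i)))"
proof (cases "k = 0")
  case True
  then show ?thesis using assms by (simp add: symmetric_sum_def qh_0)
next
  case False
  then have k: "k \<ge> 1" using assms by simp
  let ?N = "\<Sum>i=1..k. of_int (a i) * qh (- 2 * (k + 1 - i))"
  let ?S = "\<Sum>i=1..k-1. of_int (a i) * qh (2 * (k - 1 - i))"
  have "symmetric_sum a (k + 1) = ?N + (\<Sum>i=1..k+1. of_int (a i) * qh (2 * (k + 1 - i)))"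
    using k by (simp add: symmetric_sum_def distrib_left sum.distrib sum_int_last qh_0 add.assoc)
  moreover have "qh (- 2) * symmetric_sum a k = ?N + ?S"
  proof -
    have "qh (- 2) * symmetric_sum a k = (\<Sum>i=1..k-1. of_int (a i) * qh (- 2 * (k + 1 - i)))
        + ?S + of_int (a k) * qh (- 2)"
      by (simp add: symmetric_sum_def sum_distrib_left distrib_left sum.distrib mult.left_commute
          flip: qh_add) (simp add: algebra_simps)
    then show ?thesis
      using k sum_int_last[of 1 "k - 1" "\<lambda>i. of_int (a i) * qh (- 2 * (k + 1 - i))"]
      by (simp add: algebra_simps)
  qed
  moreover have "(\<Sum>i=1..k+1. of_int (a (i - 2)) * qh (2 * (k + 1 - i))) = ?S"
  proof -
    have "(\<Sum>i=1..k+1. of_int (a (i - 2)) * qh (2 * (k + 1 - i)))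
        = (\<Sum>i=-1..k-1. of_int (a i) * qh (2 * (k - 1 - i)))"
      by (rule sum.reindex_bij_witness[of _ "\<lambda>i. i + 2" "\<lambda>i. i - 2"]) (auto simp: algebra_simps)
    also have "\<dots> = ?S"
      using k assms by (simp add: sum_int_first[of "- 1" "k - 1"] sum_int_first[of 0 "k - 1"])
    finally show ?thesis .
  qed
  ultimately show ?thesis
    by (simp add: left_diff_distrib sum_subtractf)
qed

text \<open>The numerators differ by a multiple of the denominator, so the integer division is
  harmless; likewise for \<open>coef_b\<close>, where i and i - 2 moreover share their
  parity.\<close>

lemma coef_a_diff: "coef_a i - coef_a (i - 2) = 2 * i - 1"
proof -
  have "i * (i + 1) = (i - 2) * (i - 2 + 1) + (2 * i - 1) * 2"
    by (simp add: algebra_simps)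
  then show ?thesis unfolding coef_a_def
    by (simp only: div_mult_self1[of 2] simp_thms add.commute[of "(i - 2) * (i - 2 + 1)"]) simp
qed

lemma coef_b_diff: "coef_b i - coef_b (i - 2) = i - 1"
proof -
  have "i\<^sup>2 = (i - 2)\<^sup>2 + (i - 1) * 4" "i\<^sup>2 - 1 = ((i - 2)\<^sup>2 - 1) + (i - 1) * 4"
    by (simp_all add: algebra_simps power2_eq_square)
  then have "i\<^sup>2 div 4 = (i - 1) + (i - 2)\<^sup>2 div 4"
    "(i\<^sup>2 - 1) div 4 = (i - 1) + ((i - 2)\<^sup>2 - 1) div 4"
    by (simp_all only: div_mult_self1)
  then show ?thesis by (simp add: coef_b_def)
qed

text \<open>The factor 2i - 1 is the difference in \<open>coef_a_diff\<close>, so this is the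
  inhomogeneous term of \<open>symmetric_sum_step\<close>. In the odd case below, 2(i - 1) is twice
  the difference in \<open>coef_b_diff\<close>.\<close>

lemma X_coef_sum_even:
  assumes "k \<ge> 0"
  shows "qh (- 1) * X_coef_sum (2 * k) = (\<Sum>i=1..k. of_int (2 * i - 1) * qh (2 * (k - i)))"
  using assms
proof (induction k rule: int_ge_induct)
  case base
  show ?case by (simp add: X_coef_sum_def)
next
  case (step k)
  have "qh (- 1) * X_coef_sum (2 * (k + 1))
      = qh 2 * (qh (- 1) * X_coef_sum (2 * k)) + of_int (2 * k + 1)"
  proof -
    have inv: "qh (- 1) * qh 1 = 1" by (simp add: qh_0 flip: qh_add)
    show ?thesis
      using X_coef_sum_step[of "2 * k"] step.hyps
      by (simp add: distrib_left mult.left_commute[of "qh (- 1)"] inv)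
  qed
  also have "qh 2 * (qh (- 1) * X_coef_sum (2 * k)) = (\<Sum>i=1..k. of_int (2 * i - 1) * qh (2 * (k + 1 - i)))"
  proof -
    have "qh (2 * (k + 1 - i)) = qh 2 * qh (2 * (k - i))" for i
      by (simp add: algebra_simps flip: qh_add)
    then show ?thesis by (simp only: step.IH sum_distrib_left mult.left_commute)
  qed
  also have "\<dots> + of_int (2 * k + 1) = (\<Sum>i=1..k + 1. of_int (2 * i - 1) * qh (2 * (k + 1 - i)))"
    using step.hyps by (simp add: sum_int_last qh_0)
  finally show ?case .
qed

lemma X_coef_sum_odd:
  assumes "k \<ge> 1"
  shows "qh (- 1) * X_coef_sum (2 * k - 1) = (\<Sum>i=1..k. of_int (2 * (i - 1)) * qh (2 * (k - i)))"
  using assms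
proof (induction k rule: int_ge_induct)
  case base
  show ?case by (simp add: X_coef_sum_def)
next
  case (step k)
  have "qh (- 1) * X_coef_sum (2 * (k + 1) - 1)
      = qh 2 * (qh (- 1) * X_coef_sum (2 * k - 1)) + of_int (2 * k)"
  proof -
    have inv: "qh (- 1) * qh 1 = 1" by (simp add: qh_0 flip: qh_add)
    show ?thesis
      using X_coef_sum_step[of "2 * k - 1"] step.hyps
      by (simp add: distrib_left mult.left_commute[of "qh (- 1)"] inv)
  qed
  also have "qh 2 * (qh (- 1) * X_coef_sum (2 * k - 1)) = (\<Sum>i=1..k. of_int (2 * (i - 1)) * qh (2 * (k + 1 - i)))"
  proof -
    have "qh (2 * (k + 1 - i)) = qh 2 * qh (2 * (k - i))" for i
      by (simp add: algebra_simps flip: qh_add)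
    then show ?thesis by (simp only: step.IH sum_distrib_left mult.left_commute)
  qed
  also have "\<dots> + of_int (2 * k) = (\<Sum>i=1..k + 1. of_int (2 * (i - 1)) * qh (2 * (k + 1 - i)))"
    using step.hyps by (simp add: sum_int_last qh_0)
  finally show ?case .
qed

text \<open>The quantum integer \<open>q^(k-1) + q^(k-3) + ... + q^(1-k)\<close> with opposite
  powers paired; an odd k leaves the middle term 1.\<close>

definition parity_sum :: "int \<Rightarrow> laurent" where
  "parity_sum k = (if even k
     then (\<Sum>i=1..k div 2. qh (- 2 * (k + 1 - 2 * i)) + qh (2 * (k + 1 - 2 * i)))
     else (\<Sum>i=1..(k - 1) div 2. qh (- 2 * (k + 1 - 2 * i)) + qh (2 * (k + 1 - 2 * i))) + 1)"

lemma parity_sum_step2: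
  assumes "k \<ge> 0"
  shows "parity_sum (k + 2) = parity_sum k + qh (2 * (k + 1)) + qh (- 2 * (k + 1))"
proof -
  let ?f = "\<lambda>k i. qh (- 2 * (k + 1 - 2 * i)) + qh (2 * (k + 1 - 2 * i))"
  have "sum (?f (k + 2)) {1..p + 1} = ?f k 0 + sum (?f k) {1..p}" if "p \<ge> 0" for p
  proof -
    have "sum (?f (k + 2)) {1..p + 1} = sum (?f k) {0..p}"
      by (rule sum.reindex_bij_witness[of _ "\<lambda>i. i + 1" "\<lambda>i. i - 1"]) (auto simp: algebra_simps)
    then show ?thesis using that sum_int_first[of 0 p "?f k"] by simp
  qed
  from this[of "k div 2"] this[of "(k - 1) div 2"] show ?thesis
  proof (cases "even k")
    case True
    then have "(k + 2) div 2 = k div 2 + 1" "k div 2 \<ge> 0" using assms by auto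
    with True \<open>k div 2 \<ge> 0 \<Longrightarrow> _\<close> show ?thesis by (simp add: parity_sum_def)
  next
    case False
    then have "(k + 2 - 1) div 2 = (k - 1) div 2 + 1" "(k - 1) div 2 \<ge> 0" using assms by presburger+
    with False \<open>(k - 1) div 2 \<ge> 0 \<Longrightarrow> _\<close> show ?thesis by (simp add: parity_sum_def)
  qed
qed

text \<open>Division by q shifts the string of powers down and leaves only the top power
  \<open>q^k\<close> to be added. As the definition branches on parity, the induction goes in steps
  of two.\<close>

lemma parity_sum_step:
  assumes "k \<ge> 0"
  shows "parity_sum (k + 1) = qh (- 2) * parity_sum k + qh (2 * k)"
  using assms
proof (induction k rule: int_two_step_induct)
  case 0
  show ?case by (simp add: parity_sum_def qh_0)
next
  case 1
  show ?case by (simp add: parity_sum_def)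
next
  case (step k)
  have "parity_sum (k + 1 + 1) = parity_sum k + qh (2 * (k + 1)) + qh (- 2 * (k + 1))"
    using parity_sum_step2[of k] step.hyps by (simp add: add.assoc)
  also have "parity_sum k = qh (- 2) * parity_sum (k - 1) + qh (2 * (k - 1))"
    using step.IH(1) by simp
  also have "\<dots> + qh (2 * (k + 1)) + qh (- 2 * (k + 1))
      = qh (- 2) * (parity_sum (k - 1) + qh (2 * k) + qh (- 2 * k)) + qh (2 * (k + 1))"
    by ((simp add: distrib_left flip: qh_add), (simp add: algebra_simps),
        (rule arg_cong[where f = qh]), simp)
  also have "parity_sum (k - 1) + qh (2 * k) + qh (- 2 * k) = parity_sum (k + 1)"
    using parity_sum_step2[of "k - 1"] step.hyps by (simp add: add.commute)
  finally show ?case .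
qed

lemma coef_even_symmetric_sum: "coef_even h k = symmetric_sum coef_a k * h^2"
  by (simp add: coef_even_def symmetric_sum_def)

lemma coef_odd_symmetric_sum: "coef_odd h k = 2 * symmetric_sum coef_b k * h^2 + parity_sum k"
  by (simp add: coef_odd_def symmetric_sum_def parity_sum_def)

lemma coef_even_step:
  assumes "k \<ge> 0"
  shows "coef_even h (k + 1) = qh (- 2) * coef_even h k + qh (- 1) * X_coef_sum (2 * (k + 1)) * h^2"
  using assms symmetric_sum_step[of coef_a k] X_coef_sum_even[of "k + 1"]
  by (simp add: coef_even_symmetric_sum coef_a_diff) (simp add: coef_a_def algebra_simps)

lemma coef_odd_step:
  assumes "k \<ge> 0"
  shows "coef_odd h (k + 1) =
    qh (- 2) * coef_odd h k + qh (- 1) * X_coef_sum (2 * (k + 1) - 1) * h^2 + qh (2 * k)"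
proof -
  have "qh (- 1) * X_coef_sum (2 * (k + 1) - 1)
      = 2 * (\<Sum>i=1..k+1. of_int (i - 1) * qh (2 * (k + 1 - i)))"
    using assms X_coef_sum_odd[of "k + 1"] by (simp add: sum_distrib_left algebra_simps)
  then have "2 * symmetric_sum coef_b (k + 1)
      = qh (- 2) * (2 * symmetric_sum coef_b k) + qh (- 1) * X_coef_sum (2 * (k + 1) - 1)"
    using assms symmetric_sum_step[of coef_b k]
    by (simp add: coef_b_diff coef_b_def[of 0] coef_b_def[of "- 1"])
  then show ?thesis
    using parity_sum_step[OF assms]
    by (simp add: coef_odd_symmetric_sum distrib_left distrib_right mult.assoc add_ac)
qed

text \<open>The initial values 1 and \<open>h^2\<close> are the general formulas at k = 1.\<close>

lemma coef_c_even: "k \<ge> 1 \<Longrightarrow> coef_c h (2 * k) = coef_even h k"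
  by (auto simp: coef_c_def coef_even_def coef_a_def)

lemma coef_c_odd: "k \<ge> 1 \<Longrightarrow> coef_c h (2 * k - 1) = coef_odd h k"
  by (auto simp: coef_c_def coef_odd_def coef_b_def)

lemma coef_c_step:
  assumes "n \<ge> 1"
  shows "coef_c h n = of_bool (n \<ge> 3) * qh (- 2) * coef_c h (n - 2) + qh (- 1) * X_coef_sum n * h^2
    + of_bool (odd n) * qh (n - 1)"
proof (cases "even n")
  case True
  then obtain k where k: "n = 2 * (k + 1)" by (metis diff_add_cancel evenE)
  show ?thesis
  proof (cases "k = 0")
    case True
    then show ?thesis using coef_even_step[of 0 h] coef_c_even[of "k + 1" h] k
      by (simp add: coef_even_def coef_a_def)
  next
    case False
    then show ?thesis
      using assms coef_even_step[of k h] coef_c_even[of k h] coef_c_even[of "k + 1" h] k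
      by simp
  qed
next
  case False
  then obtain k where "n = 2 * k + 1" by (auto elim: oddE)
  then have k: "n = 2 * (k + 1) - 1" by simp
  show ?thesis
  proof (cases "k = 0")
    case True
    then show ?thesis using coef_odd_step[of 0 h] coef_c_odd[of "k + 1" h] k
      by (simp add: coef_odd_def coef_b_def)
  next
    case False
    have "n - 2 = 2 * k - 1" using k by simp
    then show ?thesis
      using assms False coef_odd_step[of k h] coef_c_odd[of k h] coef_c_odd[of "k + 1" h] k
      by simp
  qed
qed

section \<open>Cluster variables\<close>

locale central_scalars =
  fixes \<sigma> :: "laurent \<Rightarrow> 'f::division_ring"
  assumes hom_1: "\<sigma> 1 = 1"
    and hom_add: "\<sigma> (p + r) = \<sigma> p + \<sigma> r"
    and hom_mult: "\<sigma> (p * r) = \<sigma> p * \<sigma> r"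
    and hom_central: "\<sigma> p * x = x * \<sigma> p"
    and hom_inj: "\<sigma> p = 0 \<Longrightarrow> p = 0"
begin

lemma hom_0: "\<sigma> 0 = 0"
  using hom_add[of 0 0] by simp

lemma hom_uminus: "\<sigma> (- p) = - \<sigma> p"
  using hom_add[of p "- p"] by (simp add: hom_0 eq_neg_iff_add_eq_0 add.commute)

lemma hom_diff: "\<sigma> (p - r) = \<sigma> p - \<sigma> r"
  using hom_add[of p "- r"] by (simp add: hom_uminus)

lemma hom_sum: "\<sigma> (sum f A) = (\<Sum>i\<in>A. \<sigma> (f i))"
  by (induction A rule: infinite_finite_induct) (simp_all add: hom_0 hom_add)

lemma hom_left_commute: "x * (\<sigma> p * y) = \<sigma> p * (x * y)"
  by (metis hom_central mult.assoc)

abbreviation v where "v \<equiv> \<sigma> (qh 1)"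
abbreviation w where "w \<equiv> \<sigma> (qh (- 1))"

lemma hom_qh_2: "\<sigma> (qh 2) = v * v"
  by (simp flip: hom_mult qh_add)

lemma v_w_inverse [simp]: "v * w = 1" "w * v = 1" "v * (w * x) = x" "w * (v * x) = x"
proof -
  show "v * w = 1" "w * v = 1"
    by (simp_all add: qh_0 hom_1 flip: hom_mult qh_add)
  then show "v * (w * x) = x" "w * (v * x) = x"
    by (simp_all flip: mult.assoc)
qed

lemma v_w_nonzero [simp]: "v \<noteq> 0" "w \<noteq> 0"
  using v_w_inverse(1) by force+

text \<open>The coefficient at index 2, that of q, separates q from 1 and -1. This is what limits
  the number of roots of the exchange polynomial.\<close>

lemma v_square_neq: "v * v \<noteq> 1" "v * v \<noteq> - 1"
proof -
  have a: "qh 2 - 1 \<noteq> 0" "qh 2 + 1 \<noteq> 0"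
    by (auto simp: qh_def poly_mapping_eq_iff fun_eq_iff lookup_add lookup_minus
        lookup_single when_def lookup_one intro!: exI[of _ 2])
  show "v * v \<noteq> 1" using a hom_inj[of "qh 2 - 1"] by (auto simp: hom_diff hom_1 hom_qh_2)
  show "v * v \<noteq> - 1" using a hom_inj[of "qh 2 + 1"] by (auto simp: hom_add hom_1 hom_qh_2)
qed

end

locale kronecker_cluster = central_scalars \<sigma>
  for \<sigma> :: "laurent \<Rightarrow> 'f::division_ring" +
  fixes h :: laurent and X :: "int \<Rightarrow> 'f"
  assumes X1: "X 1 \<noteq> 0" and X2: "X 2 \<noteq> 0"
    and X12: "X 1 * X 2 = \<sigma> (qh 2) * (X 2 * X 1)"
    and exchange_relation: "X (k - 1) * X (k + 1) = \<sigma> (qh 2) * (X k)\<^sup>2 + \<sigma> (qh 1 * h) * X k + 1"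
begin

abbreviation H where "H \<equiv> \<sigma> h"

text \<open>Instantiated at a fixed a, these rules and the next ones move scalars to the left;
  \<open>H_commutes\<close> puts v and w in front of H.\<close>

lemma commutes:
  "a * v = v * a" "a * w = w * a" "a * H = H * a"
  by (simp_all add: hom_central)

lemma scalar_left_commute:
  "a * (v * x) = v * (a * x)" "a * (w * x) = w * (a * x)" "a * (H * x) = H * (a * x)"
  by (simp_all add: hom_left_commute)

lemma H_commutes:
  "H * v = v * H" "H * w = w * H" "H * (v * x) = v * (H * x)" "H * (w * x) = w * (H * x)"
  by (rule commutes scalar_left_commute)+

section \<open>The exchange polynomial, non-vanishing and q-commutation\<close>

definition exch_poly where "exch_poly x = v * (v * (x * x)) + v * (H * x) + 1"

lemma exchange: "X (k - 1) * X (k + 1) = exch_poly (X k)"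
  using exchange_relation[of k]
  by (simp add: exch_poly_def hom_qh_2 hom_mult power2_eq_square mult.assoc)

text \<open>Cluster variables do not vanish: if \<open>a b = q b a\<close>, conjugation with a turns a zero b of
  \<open>exch_poly\<close> into the further zeros \<open>q b\<close> and \<open>q\<^sup>2 b\<close>, too many for a quadratic polynomial.\<close>

lemma exch_poly_no_three_roots:
  assumes "exch_poly x = 0" "exch_poly (v * (v * x)) = 0" "exch_poly (v * (v * (v * (v * x)))) = 0"
  shows False
proof -
  have x: "x \<noteq> 0" using assms(1) by (auto simp: exch_poly_def)
  \<comment> \<open>Q is what remains of \<open>exch_poly (q y) - exch_poly y\<close> after removing
    the factors \<open>v (q - 1)\<close> and y.\<close>
  define Q where "Q x = v * (v * (v * x)) + v * x + H" for x
  have Q: "exch_poly (v * (v * y)) - exch_poly y = v * ((v * v - 1) * (Q y * y))" for y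
    by (simp add: exch_poly_def Q_def commutes[of y] scalar_left_commute[of y] H_commutes mult.assoc
        distrib_left distrib_right left_diff_distrib right_diff_distrib)
  have "Q x = 0" using Q[of x] assms x v_square_neq by simp
  moreover have "Q (v * (v * x)) = 0" using Q[of "v * (v * x)"] assms x v_square_neq by simp
  \<comment> \<open>Q is affine with slope \<open>v (q + 1)\<close>, so it cannot vanish at both x
    and q x.\<close>
  moreover have "Q (v * (v * x)) - Q x = v * ((v * v - 1) * ((v * v + 1) * x))"
    by (simp add: Q_def mult.assoc
        distrib_left distrib_right left_diff_distrib right_diff_distrib)
  ultimately show False using x v_square_neq by (simp add: add_eq_0_iff2)
qed

text \<open>The coefficients are central, and conjugation turns b into \<open>a b a^-1 = q b\<close>
  and a into \<open>b^-1 a b = q a\<close>.\<close>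

lemma exch_poly_conjugate:
  assumes "a * b = v * (v * (b * a))"
  shows "exch_poly (v * (v * b)) * a = a * exch_poly b" "b * exch_poly (v * (v * a)) = exch_poly a * b"
proof -
  have abx: "a * (b * x) = v * (v * (b * (a * x)))" for x
    by (metis assms mult.assoc)
  note comm = commutes[of a] commutes[of b] scalar_left_commute[of a] scalar_left_commute[of b]
    H_commutes
  show "exch_poly (v * (v * b)) * a = a * exch_poly b" "b * exch_poly (v * (v * a)) = exch_poly a * b"
    by (simp_all add: exch_poly_def abx assms comm mult.assoc distrib_left distrib_right)
qed

lemma exch_poly_nonzero:
  assumes "a \<noteq> 0" "b \<noteq> 0" "a * b = v * (v * (b * a))"
  shows "exch_poly b \<noteq> 0" "exch_poly a \<noteq> 0"
proof -
  note comm = commutes[of a] commutes[of b] scalar_left_commute[of a] scalar_left_commute[of b]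
  \<comment> \<open>The pairs (a, q b) and (q a, b) q-commute as well, so the conjugation can be
    applied a second time.\<close>
  have "a * (v * (v * b)) = v * (v * (v * (v * b) * a))"
    "v * (v * a) * b = v * (v * (b * (v * (v * a))))"
    by (simp_all add: comm assms(3) mult.assoc)
  note conj = exch_poly_conjugate[OF assms(3)] exch_poly_conjugate(1)[OF this(1)]
    exch_poly_conjugate(2)[OF this(2)]
  show "exch_poly b \<noteq> 0" using conj exch_poly_no_three_roots[of b] assms(1) by auto
  show "exch_poly a \<noteq> 0" using conj exch_poly_no_three_roots[of a] assms(2) by auto
qed

text \<open>Each new variable has an exchange polynomial as its product with a known one, hence is
  nonzero. The polynomial commutes with its own argument, and cancelling the known factor leaves the
  q-commutation.\<close>

lemma q_commute_step:
  assumes "X k \<noteq> 0" "X (k + 1) \<noteq> 0" "X k * X (k + 1) = v * (v * (X (k + 1) * X k))"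
  shows "X (k + 2) \<noteq> 0" "X (k + 1) * X (k + 2) = v * (v * (X (k + 2) * X (k + 1)))"
    "X (k - 1) \<noteq> 0" "X (k - 1) * X k = v * (v * (X k * X (k - 1)))"
proof -
  define a b c d where "a = X k" and "b = X (k + 1)" and "c = X (k - 1)" and "d = X (k + 2)"
  note comm = commutes[of a] commutes[of b] scalar_left_commute[of a] scalar_left_commute[of b]
    H_commutes
  have ab: "a * b = v * (v * (b * a))" and a: "a \<noteq> 0" and b: "b \<noteq> 0"
    using assms by (simp_all add: a_def b_def)
  have abx: "a * (b * x) = v * (v * (b * (a * x)))" for x
    by (metis ab mult.assoc)
  have ad: "a * d = exch_poly b" using exchange[of "k + 1"] by (simp add: a_def b_def d_def add.commute)
  have cb: "c * b = exch_poly a" using exchange[of k] by (simp add: a_def b_def c_def)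
  note nonzero = exch_poly_nonzero[OF a b ab]
  show "X (k + 2) \<noteq> 0" using nonzero ad by (auto simp: d_def)
  show "X (k - 1) \<noteq> 0" using nonzero cb by (auto simp: c_def)
  have "a * (b * d) = a * (v * (v * (d * b)))"
  proof -
    have "a * (b * d) = v * (v * (b * exch_poly b))" by (simp add: abx ad)
    also have "b * exch_poly b = exch_poly b * b"
      by (simp add: exch_poly_def comm mult.assoc distrib_left distrib_right)
    also have "v * (v * (exch_poly b * b)) = a * (v * (v * (d * b)))"
      by (simp add: ad[symmetric] commutes[of a] scalar_left_commute[of a] mult.assoc)
    finally show ?thesis .
  qed
  then show "X (k + 1) * X (k + 2) = v * (v * (X (k + 2) * X (k + 1)))"
    using a by (simp add: b_def d_def)
  have "(c * a) * b = (v * (v * (a * c))) * b"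
  proof -
    have "(c * a) * b = v * (v * ((c * b) * a))"
      by (simp add: ab scalar_left_commute[of c] mult.assoc)
    also have "(c * b) * a = a * (c * b)" unfolding cb
      by (simp add: exch_poly_def comm mult.assoc distrib_left distrib_right)
    finally show ?thesis by (simp add: mult.assoc)
  qed
  then show "X (k - 1) * X k = v * (v * (X k * X (k - 1)))"
    using b by (simp add: a_def c_def)
qed

lemma nonzero_commute:
  "X k \<noteq> 0 \<and> X (k + 1) \<noteq> 0 \<and> X k * X (k + 1) = v * (v * (X (k + 1) * X k))"
proof (induction k rule: int_induct[where k = 1])
  case base
  show ?case using X1 X2 X12 by (simp add: hom_qh_2 mult.assoc)
next
  case (step1 i)
  then show ?case using q_commute_step(1,2)[of i] by (simp add: add.assoc)
next
  case (step2 i)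
  then show ?case using q_commute_step(3,4)[of i] by simp
qed

lemma X_nonzero: "X k \<noteq> 0"
  using nonzero_commute by blast

lemma q_commute: "X k * X (k + 1) = v * (v * (X (k + 1) * X k))"
  using nonzero_commute by blast

section \<open>The element \<open>X_delta\<close> formed with an arbitrary pair of
  neighbours\<close>

definition shifted_delta where
  "shifted_delta k = v * X (k - 1) * X (k + 2) - v * (v * X k + H) * (v * X (k + 1) + H)"

abbreviation \<delta> where "\<delta> \<equiv> shifted_delta 1"

text \<open>Moving \<open>X k\<close> past \<open>X (k - 1)\<close> lets two exchange relations be
  applied in turn to the product of the outer variables; the terms of higher degree then
  cancel.\<close>

lemma X_mult_shifted_delta:
  "X k * shifted_delta k = w * X (k - 1) + v * X (k + 1) + H"
  "X (k + 1) * shifted_delta k = w * X k + v * X (k + 2) + H"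
proof -
  define a b c d where "a = X k" and "b = X (k + 1)" and "c = X (k - 1)" and "d = X (k + 2)"
  note comm = commutes[of a] commutes[of b] commutes[of c] commutes[of d]
    scalar_left_commute[of a] scalar_left_commute[of b]
    scalar_left_commute[of c] scalar_left_commute[of d] H_commutes
  have ab: "a * b = v * (v * (b * a))" using q_commute[of k] by (simp add: a_def b_def)
  have ca: "c * a = v * (v * (a * c))" using q_commute[of "k - 1"] by (simp add: a_def c_def)
  have ad: "a * d = exch_poly b" using exchange[of "k + 1"] by (simp add: a_def b_def d_def add.commute)
  have cb: "c * b = exch_poly a" using exchange[of k] by (simp add: a_def b_def c_def)
  have D: "shifted_delta k = v * (c * d) - v * ((v * a + H) * (v * b + H))"
    by (simp add: shifted_delta_def a_def b_def c_def d_def mult.assoc)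
  have b: "b \<noteq> 0" by (simp add: b_def X_nonzero)
  have ba: "b * a = w * (w * (a * b))" by (simp add: ab)
  have bax: "b * (a * x) = w * (w * (a * (b * x)))" for x
    using ba by (metis mult.assoc)
  have "a * c = w * (w * (c * a))" by (simp add: ca)
  then have "a * (c * d) = w * (w * (c * (a * d)))" by (metis mult.assoc)
  also have "\<dots> = w * (w * (v * (v * ((c * b) * b)) + v * (H * (c * b)) + c))"
    unfolding ad by (simp add: exch_poly_def comm mult.assoc distrib_left)
  also have "\<dots> = exch_poly a * b + w * (H * exch_poly a) + w * (w * c)"
    unfolding cb by (simp add: distrib_left comm)
  finally have acd: "a * (c * d) = exch_poly a * b + w * (H * exch_poly a) + w * (w * c)" .
  have "a * shifted_delta k = v * (a * (c * d)) - v * (a * ((v * a + H) * (v * b + H)))"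
    by (simp add: D right_diff_distrib comm)
  also have "\<dots> = w * c + v * b + H"
    unfolding acd by (simp add: exch_poly_def comm mult.assoc distrib_left distrib_right)
  finally show "X k * shifted_delta k = w * X (k - 1) + v * X (k + 1) + H"
    by (simp add: a_def b_def c_def)
  \<comment> \<open>The exchange relation gives c b, not b c. The latter is found by moving b past
    \<open>exch_poly a\<close> and cancelling b on the right.\<close>
  have "(b * c) * b = (w * (w * (a * a)) + w * (H * a) + 1) * b"
  proof -
    have "(b * c) * b = b * exch_poly a" by (simp add: cb mult.assoc)
    also have "\<dots> = (w * (w * (a * a)) + w * (H * a) + 1) * b"
      by (simp add: exch_poly_def comm bax ba mult.assoc distrib_left distrib_right)
    finally show ?thesis .
  qed
  then have bc: "b * c = w * (w * (a * a)) + w * (H * a) + 1" using b by simp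
  have "b * (c * d) = (b * c) * d" by (simp add: mult.assoc)
  also have "\<dots> = w * (w * (a * (a * d))) + w * (H * (a * d)) + d"
    unfolding bc by (simp add: distrib_right mult.assoc)
  finally have bcd: "b * (c * d) = w * (w * (a * exch_poly b)) + w * (H * exch_poly b) + d"
    unfolding ad .
  have "b * shifted_delta k = v * (b * (c * d)) - v * (b * ((v * a + H) * (v * b + H)))"
    by (simp add: D right_diff_distrib comm)
  also have "\<dots> = w * a + v * d + H"
    unfolding bcd by (simp add: exch_poly_def comm mult.assoc ba bax distrib_left distrib_right)
  finally show "X (k + 1) * shifted_delta k = w * X k + v * X (k + 2) + H"
    by (simp add: a_def b_def d_def)
qed

text \<open>The second formula for k and the first one for k + 1 have the same right-hand side, and
  \<open>X (k + 1)\<close> can be cancelled.\<close>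

lemma shifted_delta_eq: "shifted_delta k = \<delta>"
proof -
  have step: "shifted_delta (k + 1) = shifted_delta k" for k
  proof -
    have "X (k + 1) * shifted_delta (k + 1) = X (k + 1) * shifted_delta k"
      using X_mult_shifted_delta(1)[of "k + 1"] X_mult_shifted_delta(2)[of k]
      by (simp add: add.assoc)
    then show ?thesis by (simp add: X_nonzero)
  qed
  show ?thesis
  proof (induction k rule: int_induct[where k = 1])
    case (step1 i)
    then show ?case using step[of i] by simp
  next
    case (step2 i)
    then show ?case using step[of "i - 1"] by simp
  qed simp
qed

lemma X_mult_delta: "X k * \<delta> = w * X (k - 1) + v * X (k + 1) + H"
  using X_mult_shifted_delta(1)[of k] by (simp add: shifted_delta_eq[of k])

section \<open>Products with Chebyshev polynomials\<close>

lemma scaled_X_mult_delta: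
  "\<sigma> p * X k * \<delta> = \<sigma> (p * qh (- 1)) * X (k - 1) + \<sigma> (p * qh 1) * X (k + 1) + \<sigma> (p * h)"
  by (simp add: mult.assoc X_mult_delta distrib_left hom_mult)

text \<open>The extra scalar is the correction in \<open>cheb_mult_arg\<close> at
  \<open>F_1\<close>, which occurs at k = n - 1. The second sum stops at n - 1 because
  \<open>F_(-1) = 0\<close>.\<close>

lemma cheb_sum_mult_delta:
  assumes "n \<ge> 0"
  shows "(\<Sum>k=1..n. \<sigma> (c k) * cheb (n - k) \<delta>) * \<delta> =
    (\<Sum>k=1..n. \<sigma> (c k) * cheb (n + 1 - k) \<delta>)
    + (\<Sum>k=1..n-1. \<sigma> (c k) * cheb (n - 1 - k) \<delta>) + \<sigma> (of_bool (n \<ge> 2) * c (n - 1))"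
proof -
  have "\<sigma> (c k) * cheb (n - k) \<delta> * \<delta> = \<sigma> (c k) * cheb (n + 1 - k) \<delta>
      + \<sigma> (c k) * cheb (n - 1 - k) \<delta> + (if k = n - 1 then \<sigma> (c k) else 0)" if "k \<in> {1..n}" for k
  proof -
    have "n - k + 1 = n + 1 - k" "n - k - 1 = n - 1 - k" "n - k = 1 \<longleftrightarrow> k = n - 1" "n - k \<noteq> - 1"
      using that by auto
    then have "cheb (n - k) \<delta> * \<delta> =
        cheb (n + 1 - k) \<delta> + cheb (n - 1 - k) \<delta> + of_bool (k = n - 1)"
      by (simp only: cheb_mult_arg of_bool_eq(1) diff_zero)
    then show ?thesis by (simp add: mult.assoc distrib_left)
  qed
  then have "(\<Sum>k=1..n. \<sigma> (c k) * cheb (n - k) \<delta>) * \<delta> =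
    (\<Sum>k=1..n. \<sigma> (c k) * cheb (n + 1 - k) \<delta>)
    + (\<Sum>k=1..n. \<sigma> (c k) * cheb (n - 1 - k) \<delta>)
    + (\<Sum>k=1..n. if k = n - 1 then \<sigma> (c k) else 0)"
    by (simp add: sum_distrib_right sum.distrib)
  also have "(\<Sum>k=1..n. \<sigma> (c k) * cheb (n - 1 - k) \<delta>)
      = (\<Sum>k=1..n-1. \<sigma> (c k) * cheb (n - 1 - k) \<delta>)"
    using assms by (intro sum.mono_neutral_right) (auto simp: cheb_neg)
  also have "(\<Sum>k=1..n. if k = n - 1 then \<sigma> (c k) else 0) = \<sigma> (of_bool (n \<ge> 2) * c (n - 1))"
    by (simp add: hom_0)
  finally show ?thesis .
qed

lemma X_mult_cheb_G:
  assumes "n \<ge> 0"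
  shows "X m * cheb_G n \<delta> = \<sigma> (qh (- n)) * X (m - n) + \<sigma> (qh n) * X (m + n)
    + (\<Sum>k=1..n. \<sigma> (qint k * h) * cheb (n - k) \<delta>)"
  using assms
proof (induction n rule: int_two_step_induct)
  case 0
  show ?case by (simp add: cheb_G_def qh_0 hom_1 mult_2_right)
next
  case 1
  show ?case by (simp add: cheb_G_def cheb_def X_mult_delta qint_def qh_0)
next
  case (step n)
  let ?S = "\<lambda>n. \<Sum>k=1..n. \<sigma> (qint k * h) * cheb (n - k) \<delta>"
  \<comment> \<open>The shifted sum lacks the last summand of \<open>?S (n + 1)\<close>; the scalar
    with \<open>qint (n - 1)\<close> is the correction at \<open>F_1\<close>. By
    \<open>qint_step\<close> their difference is the sum of the two H-terms from
    \<open>X_mult_delta\<close>.\<close>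
  have S: "?S n * \<delta> = ?S (n + 1) - \<sigma> (qint (n + 1) * h) + ?S (n - 1) + \<sigma> (qint (n - 1) * h)"
  proof -
    have "of_bool (n \<ge> 2) * (qint (n - 1) * h) = qint (n - 1) * h"
      using step.hyps by (cases "n = 1") (simp_all add: qint_def)
    from cheb_sum_mult_delta[of n "\<lambda>k. qint k * h", unfolded this] show ?thesis
      using step.hyps by (simp add: sum_int_last)
  qed
  have "X m * cheb_G (n + 1) \<delta> = (X m * cheb_G n \<delta>) * \<delta> - X m * cheb_G (n - 1) \<delta>"
  proof -
    have "cheb_G (n + 1) \<delta> = cheb_G n \<delta> * \<delta> - cheb_G (n - 1) \<delta>"
      using cheb_G_step[of "n - 1" \<delta>] step.hyps by (simp add: add.commute)
    then show ?thesis by (simp add: right_diff_distrib mult.assoc)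
  qed
  also have "\<dots> = \<sigma> (qh (- n)) * X (m - n) * \<delta> + \<sigma> (qh n) * X (m + n) * \<delta> + ?S n * \<delta>
      - (\<sigma> (qh (- (n - 1))) * X (m - (n - 1)) + \<sigma> (qh (n - 1)) * X (m + (n - 1)) + ?S (n - 1))"
    unfolding step.IH by (simp only: distrib_right)
  also have "\<dots> = \<sigma> (qh (- (n + 1))) * X (m - (n + 1)) + \<sigma> (qh (n + 1)) * X (m + (n + 1))
      + ?S (n + 1)"
  proof -
    have i: "m - n - 1 = m - (n + 1)" "m - n + 1 = m - (n - 1)" "m + n - 1 = m + (n - 1)"
       "m + n + 1 = m + (n + 1)" by simp_all
    have q: "qh (- n) * qh (- 1) = qh (- (n + 1))" "qh (- n) * qh 1 = qh (- (n - 1))"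
      "qh n * qh (- 1) = qh (n - 1)" "qh n * qh 1 = qh (n + 1)"
      by (simp_all flip: qh_add)
    have "\<sigma> (qint (n + 1) * h) = \<sigma> (qint (n - 1) * h) + \<sigma> (qh n * h) + \<sigma> (qh (- n) * h)"
      using qint_step[OF step.hyps(1)] by (simp add: distrib_right hom_add)
    then show ?thesis
      unfolding S scaled_X_mult_delta i q by (simp only:) (simp only: algebra_simps)
  qed
  finally show ?case .
qed

section \<open>The three parts of a product of two cluster variables\<close>

definition leading_part where
  "leading_part m n = \<sigma> (qh (2 * (n div 2))) * X (m + n div 2) * X (m + (n + 1) div 2)"

definition linear_part where
  "linear_part m n = (\<Sum>j=1..n-1. \<sigma> (X_coef n j * h) * X (m + j))"

definition delta_part where
  "delta_part n = (\<Sum>l=1..n-1. \<sigma> (qh (- (n - 1 - l)) * coef_c h l) * cheb (n - 1 - l) \<delta>)"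

text \<open>For even n, q-commutation makes the old leading terms cancel; for odd n they cancel
  directly, and an exchange relation yields the new leading term, a further linear term and a
  constant.\<close>

lemma leading_part_step:
  assumes "n \<ge> 1"
  shows "w * (leading_part m n * \<delta>) - w * (w * leading_part m (n - 1)) = leading_part m (n + 1)
    + \<sigma> (qh (2 * (n div 2) - 1) * h) * X (m + n div 2)
    + \<sigma> (of_bool (odd n) * qh n * h) * X (m + (n + 1) div 2) + \<sigma> (of_bool (odd n) * qh (n - 1))"
proof -
  define p where "p = n div 2"
  define s a b c where "s = \<sigma> (qh (2 * p))" and "a = X (m + p - 1)" and "b = X (m + p)"
    and "c = X (m + p + 1)"
  have s: "\<sigma> (qh (2 * p - 1)) = w * s" "\<sigma> (qh (2 * p - 2)) = w * (w * s)"
     "\<sigma> (qh (2 * p + 1)) = v * s" "\<sigma> (qh (2 * p + 2)) = v * (v * s)"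
    by (simp_all add: s_def add.commute flip: hom_mult qh_add)
  note comm = commutes[of a] commutes[of b] commutes[of c] commutes[of s]
    scalar_left_commute[of a] scalar_left_commute[of b]
    scalar_left_commute[of c] scalar_left_commute[of s] H_commutes
  have r: "\<sigma> (qh (2 * (n div 2) - 1) * h) * X (m + n div 2) = w * (s * (H * b))"
    by (simp only: p_def[symmetric] hom_mult s b_def mult.assoc)
  show ?thesis
  proof (cases "even n")
    case True
    then have n: "n = 2 * p" by (simp add: p_def)
    have "a * b = v * (v * (b * a))" using q_commute[of "m + p - 1"] by (simp add: a_def b_def)
    then have ba: "b * a = w * (w * (a * b))" by simp
    have bd: "b * \<delta> = w * a + v * c + H" unfolding a_def b_def c_def by (rule X_mult_delta)
    have "leading_part m n = s * (b * b)" "leading_part m (n - 1) = w * (w * (s * (a * b)))"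
      "leading_part m (n + 1) = s * (b * c)"
    proof -
      have "(2 * p - 1) div 2 = p - 1" "(2 * p + 1) div 2 = p" by presburger+
      then show "leading_part m n = s * (b * b)" "leading_part m (n - 1) = w * (w * (s * (a * b)))"
        "leading_part m (n + 1) = s * (b * c)"
        by (simp_all add: leading_part_def n s_def a_def b_def c_def mult.assoc s[unfolded s_def]
            add_diff_eq add.assoc)
    qed
    then show ?thesis
      using True r by (simp add: hom_0 ba bd comm mult.assoc distrib_left)
  next
    case False
    then have n: "n = 2 * p + 1" by (simp add: p_def)
    define d where "d = X (m + p + 2)"
    have bd: "b * d = exch_poly c" using exchange[of "m + p + 1"]
      by (simp add: b_def c_def d_def algebra_simps)
    have cd: "c * \<delta> = w * b + v * d + H"
      using X_mult_delta[of "m + p + 1"] by (simp add: b_def c_def d_def add.assoc)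
    have "leading_part m n = s * (b * c)" "leading_part m (n - 1) = s * (b * b)"
      "leading_part m (n + 1) = v * (v * (s * (c * c)))"
      by (simp_all add: leading_part_def n s_def b_def c_def mult.assoc s[unfolded s_def] add.assoc)
    moreover have "\<sigma> (qh n * h) * X (m + (n + 1) div 2) = v * (s * (H * c))"
    proof -
      have "(n + 1) div 2 = p + 1" by (simp add: n)
      then show ?thesis by (simp only: n s hom_mult c_def mult.assoc add.assoc)
    qed
    moreover have "\<sigma> (qh (n - 1)) = s"
      by (simp add: n s_def)
    ultimately show ?thesis
      using False r by (simp add: bd cd exch_poly_def comm mult.assoc distrib_left)
  qed
qed

lemma linear_part_extend: "linear_part m n = (\<Sum>j=0..N. \<sigma> (X_coef n j * h) * X (m + j))" if "n - 1 \<le> N"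
  unfolding linear_part_def
  using sum_shift_int[of 1 "n - 1" "\<lambda>j. \<sigma> (X_coef n j * h) * X (m + j)" 0 0 N] that
  by (simp add: X_coef_outside hom_0)

text \<open>Comparing coefficients of \<open>X (m + j)\<close> reduces this to
  \<open>X_coef_step\<close>, which absorbs the linear terms left by the leading part. The summands
  h in \<open>X_mult_delta\<close> add up to the constant with \<open>X_coef_sum\<close>.\<close>

lemma linear_part_step:
  assumes "n \<ge> 1"
  shows "w * (linear_part m n * \<delta>) - w * (w * linear_part m (n - 1)) - \<sigma> (qh (- 1) * h) * X m
    + \<sigma> (qh (2 * (n div 2) - 1) * h) * X (m + n div 2)
    + \<sigma> (of_bool (odd n) * qh n * h) * X (m + (n + 1) div 2)
    = linear_part m (n + 1) + \<sigma> (qh (- 1) * X_coef_sum n * h^2)"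
proof -
  have "\<sigma> (X_coef (n + 1) j * h) * X (m + j)
      = \<sigma> (qh (- 2) * X_coef n (j + 1) * h) * X (m + j) + \<sigma> (X_coef n (j - 1) * h) * X (m + j)
      + (if j = n div 2 then \<sigma> (qh (2 * (n div 2) - 1) * h) * X (m + j) else 0)
      + (if j = (n + 1) div 2 then \<sigma> (of_bool (odd n) * qh n * h) * X (m + j) else 0)
      - (if j = 0 then \<sigma> (qh (- 1) * h) * X (m + j) else 0)
      - w * (w * (\<sigma> (X_coef (n - 1) j * h) * X (m + j)))" if "j \<in> {0..n}" for j
  proof -
    have "X_coef (n + 1) j =
      qh (- 2) * X_coef n (j + 1) + X_coef n (j - 1)
      + of_bool (j = n div 2) * qh (2 * (n div 2) - 1)
      + of_bool (odd n \<and> j = (n + 1) div 2) * qh n - of_bool (j = 0) * qh (- 1)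
      - qh (- 1) * qh (- 1) * X_coef (n - 1) j"
      using X_coef_step[of n j] that assms by (simp add: algebra_simps flip: qh_add)
    then show ?thesis
      by (auto simp: distrib_right left_diff_distrib hom_add hom_diff hom_mult hom_0 hom_1 mult.assoc)
  qed
  \<comment> \<open>The special indices must lie in 0..n for the conditional summands to be picked
    up.\<close>
  moreover have bounds: "n div 2 \<le> n" "odd n \<Longrightarrow> n div 2 + 1 \<le> n" using assms by presburger+
  ultimately have "linear_part m (n + 1) = (\<Sum>j=0..n. \<sigma> (qh (- 2) * X_coef n (j + 1) * h) * X (m + j))
      + (\<Sum>j=0..n. \<sigma> (X_coef n (j - 1) * h) * X (m + j))
      + \<sigma> (qh (2 * (n div 2) - 1) * h) * X (m + n div 2)
      + \<sigma> (of_bool (odd n) * qh n * h) * X (m + (n + 1) div 2)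
      - \<sigma> (qh (- 1) * h) * X m
      - w * (w * linear_part m (n - 1))"
    using assms bounds
    by (simp add: linear_part_extend[of "n + 1" n] linear_part_extend[of "n - 1" n]
        sum.distrib sum_subtractf
        flip: sum_distrib_left)
  moreover have "w * (linear_part m n * \<delta>) = (\<Sum>j=0..n. \<sigma> (qh (- 2) * X_coef n (j + 1) * h) * X (m + j))
      + (\<Sum>j=0..n. \<sigma> (X_coef n (j - 1) * h) * X (m + j)) + \<sigma> (qh (- 1) * X_coef_sum n * h^2)"
  proof -
    have "w * (\<sigma> (X_coef n j * h) * X (m + j) * \<delta>)
       = \<sigma> (qh (- 2) * X_coef n j * h) * X (m + j - 1) + \<sigma> (X_coef n j * h) * X (m + j + 1)
         + \<sigma> (qh (- 1) * h^2 * X_coef n j)" for j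
    proof -
      have p: "qh (- 1) * X_coef n j * h * qh (- 1) = qh (- 2) * X_coef n j * h"
        "qh (- 1) * X_coef n j * h * qh 1 = X_coef n j * h"
        "qh (- 1) * X_coef n j * h * h = qh (- 1) * h^2 * X_coef n j"
        using qh_add[of "- 1" "- 1"] qh_add[of "- 1" 1]
        by (simp_all add: algebra_simps power2_eq_square qh_0)
      show ?thesis
        unfolding scaled_X_mult_delta distrib_left mult.assoc[symmetric] hom_mult[symmetric] p ..
    qed
    then have "w * (linear_part m n * \<delta>) = (\<Sum>j=1..n-1. \<sigma> (qh (- 2) * X_coef n j * h) * X (m + j - 1))
      + (\<Sum>j=1..n-1. \<sigma> (X_coef n j * h) * X (m + j + 1))
      + \<sigma> (qh (- 1) * h^2 * X_coef_sum n)"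
      unfolding X_coef_sum_def
      by (simp add: linear_part_def sum_distrib_left sum_distrib_right sum.distrib hom_sum)
    also have "(\<Sum>j=1..n-1. \<sigma> (qh (- 2) * X_coef n j * h) * X (m + j - 1))
        = (\<Sum>j=0..n. \<sigma> (qh (- 2) * X_coef n (j + 1) * h) * X (m + (j + 1) - 1))"
      by (rule sum_shift_int[symmetric]) (auto simp: X_coef_outside hom_0)
    \<comment> \<open>Writing \<open>j + - 1\<close> matches the shift by d = -1 in
      \<open>sum_shift_int\<close>.\<close>
    also have "(\<Sum>j=1..n-1. \<sigma> (X_coef n j * h) * X (m + j + 1))
        = (\<Sum>j=0..n. \<sigma> (X_coef n (j + - 1) * h) * X (m + (j + - 1) + 1))"
      by (rule sum_shift_int[symmetric]) (auto simp: X_coef_outside hom_0)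
    finally show ?thesis by (simp add: mult_ac)
  qed
  ultimately show ?thesis by simp
qed

text \<open>The sums with \<open>cheb (n - 2 - l)\<close> cancel, those with
  \<open>cheb (n - l)\<close> pass to the next delta part, and by \<open>coef_c_step\<close> the
  scalars combine to the new constant \<open>coef_c h n\<close>.\<close>

lemma delta_part_step:
  assumes "n \<ge> 1"
  shows "w * (delta_part n * \<delta>) - w * (w * delta_part (n - 1)) + \<sigma> (qh (- 1) * X_coef_sum n * h^2)
    + \<sigma> (of_bool (odd n) * qh (n - 1)) = delta_part (n + 1)"
proof -
  let ?c = "\<lambda>l. qh (- (n - 1 - l)) * coef_c h l"
  have "delta_part n * \<delta> = (\<Sum>l=1..n-1. \<sigma> (?c l) * cheb (n - l) \<delta>)
    + (\<Sum>l=1..n-2. \<sigma> (?c l) * cheb (n - 2 - l) \<delta>) + \<sigma> (of_bool (n \<ge> 3) * (qh (- 1) * coef_c h (n - 2)))"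
    using cheb_sum_mult_delta[of "n - 1" ?c] assms by (simp add: delta_part_def)
  moreover have "w * (w * delta_part (n - 1)) = w * (\<Sum>l=1..n-2. \<sigma> (?c l) * cheb (n - 2 - l) \<delta>)"
  proof -
    have "w * \<sigma> (qh (- (n - 2 - l)) * coef_c h l) = \<sigma> (?c l)" for l
      by (simp add: algebra_simps flip: hom_mult qh_add mult.assoc)
    then show ?thesis
      by (simp add: delta_part_def sum_distrib_left flip: mult.assoc)
  qed
  moreover have "delta_part (n + 1) = w * (\<Sum>l=1..n-1. \<sigma> (?c l) * cheb (n - l) \<delta>) + \<sigma> (coef_c h n)"
  proof -
    have "w * \<sigma> (?c l) = \<sigma> (qh (- (n - l)) * coef_c h l)" for l
      by (simp add: algebra_simps flip: hom_mult qh_add mult.assoc)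
    then show ?thesis
      using assms sum_int_last[of 1 "n - 1" "\<lambda>l. \<sigma> (qh (- (n - l)) * coef_c h l) * cheb (n - l) \<delta>"]
      by (simp add: delta_part_def sum_distrib_left qh_0 flip: mult.assoc)
  qed
  moreover have "\<sigma> (coef_c h n) = w * \<sigma> (of_bool (n \<ge> 3) * (qh (- 1) * coef_c h (n - 2)))
     + \<sigma> (qh (- 1) * X_coef_sum n * h^2) + \<sigma> (of_bool (odd n) * qh (n - 1))"
  proof -
    have "of_bool (n \<ge> 3) * qh (- 2) * coef_c h (n - 2)
      = qh (- 1) * (of_bool (n \<ge> 3) * (qh (- 1) * coef_c h (n - 2)))"
      using qh_add[of "- 1" "- 1"] by (simp add: mult_ac)
    then show ?thesis by (subst coef_c_step[OF assms]) (simp only: hom_add hom_mult[of "qh (- 1)"])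
  qed
  ultimately show ?thesis by (simp add: distrib_left)
qed

text \<open>What the leading part leaves over is consumed by the linear and delta parts, and the
  constant left by the linear part goes into the delta part.\<close>

lemma X_mult_X:
  assumes "n \<ge> 0"
  shows "X m * X (m + n) = leading_part m n + linear_part m n + delta_part n"
  using assms
proof (induction n rule: int_two_step_induct)
  case 0
  show ?case by (simp add: leading_part_def linear_part_def delta_part_def qh_0 hom_1)
next
  case 1
  show ?case by (simp add: leading_part_def linear_part_def delta_part_def qh_0 hom_1)
next
  case (step n)
  have "X (m + (n + 1)) = w * (X (m + n) * \<delta>) - w * (w * X (m + (n - 1))) - w * H"
    using X_mult_delta[of "m + n"] by (simp add: distrib_left add_ac add_diff_eq)
  then have "X m * X (m + (n + 1)) = w * (X m * X (m + n) * \<delta>) - w * (w * (X m * X (m + (n - 1))))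
     - \<sigma> (qh (- 1) * h) * X m"
    by (simp add: right_diff_distrib scalar_left_commute[of "X m"] commutes[of "X m"]
        mult.assoc hom_mult)
  also have "\<dots> = leading_part m (n + 1) + linear_part m (n + 1) + delta_part (n + 1)"
    unfolding step.IH distrib_left distrib_right
    using leading_part_step[OF step.hyps, of m] linear_part_step[OF step.hyps, of m]
      delta_part_step[OF step.hyps]
    by (simp add: algebra_simps)
  finally show ?case .
qed
end

section \<open>Passage to the skew-field of fractions\<close>

lemma kronecker_cluster_sc:
  assumes "skew_field_of_fractions \<iota>" "cluster_variables \<iota> h X"
  shows "kronecker_cluster (sc \<iota>) h X"
proof -
  have \<iota>: "\<iota> 1 = 1" "\<iota> (x + y) = \<iota> x + \<iota> y" "\<iota> (x * y) = \<iota> x * \<iota> y" "inj \<iota>" for x y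
    using assms(1) by (auto simp: skew_field_of_fractions_def)
  have "\<iota> 0 = 0" using \<iota>(2)[of 0 0] by simp
  then have \<iota>_0: "\<iota> x = 0 \<longleftrightarrow> x = 0" for x
    using \<iota>(4) by (metis injD)
  have single_0: "of_coeffs (Poly_Mapping.single a p) = 0 \<longleftrightarrow> p = 0" for a p
    by (metis UNIV_I of_coeffs_inject single_zero lookup_single_eq lookup_zero zero_qtorus_def)
  have X12: "X 1 = \<iota> (qX (1, 0))" "X 2 = \<iota> (qX (0, 1))"
    using assms(2) by (auto simp: cluster_variables_def)
  show ?thesis
  proof
    show "sc \<iota> 1 = 1" by (simp add: sc_def scalar_1 \<iota>)
    show "sc \<iota> (p + r) = sc \<iota> p + sc \<iota> r" "sc \<iota> (p * r) = sc \<iota> p * sc \<iota> r" for p r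
      by (simp_all add: sc_def scalar_add scalar_mult \<iota>)
    show "p = 0" if "sc \<iota> p = 0" for p
      using that by (simp add: sc_def \<iota>_0 scalar_def single_0)
    show "sc \<iota> p * z = z * sc \<iota> p" for p z
    proof -
      obtain x y where y: "y \<noteq> 0" and z: "z = \<iota> x * inverse (\<iota> y)"
        using assms(1) unfolding skew_field_of_fractions_def by blast
      \<comment> \<open>Scalars commute with the image, hence with inverses of its elements, hence
        with all fractions.\<close>
      have central: "sc \<iota> p * \<iota> x = \<iota> x * sc \<iota> p" for x
        by (simp add: sc_def scalar_central flip: \<iota>(3))
      have "sc \<iota> p * inverse (\<iota> y) = inverse (\<iota> y) * sc \<iota> p"
        using mult_commute_imp_mult_inverse_commute[OF central[of y, symmetric]] by simp
      then show ?thesis unfolding z by (metis central mult.assoc)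
    qed
    show "X 1 \<noteq> 0" "X 2 \<noteq> 0"
      by (simp_all add: X12 \<iota>_0 qX_def single_0)
    show "X 1 * X 2 = sc \<iota> (qh 2) * (X 2 * X 1)"
      by (simp add: X12 sc_def qX_1_2 flip: \<iota>(3))
    show "X (k - 1) * X (k + 1) = sc \<iota> (qh 2) * (X k)\<^sup>2 + sc \<iota> (qh 1 * h) * X k + 1" for k
      using assms(2) by (simp add: cluster_variables_def)
  qed
qed

theorem theorem3p3:
  fixes h :: laurent
    and \<iota> :: "qtorus \<Rightarrow> 'f::division_ring"
    and X :: "int \<Rightarrow> 'f"
    and m n :: int
  assumes "bar h = h"
    and "skew_field_of_fractions \<iota>"
    and "cluster_variables \<iota> h X"
  shows
    "(m > n \<and> n \<ge> 1 \<longrightarrow>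
        cheb m (X_delta \<iota> h X) * cheb n (X_delta \<iota> h X)
        = cheb (m + n) (X_delta \<iota> h X) + cheb (m - n) (X_delta \<iota> h X))
     \<and>
     (n \<ge> 1 \<longrightarrow>
        cheb n (X_delta \<iota> h X) * cheb n (X_delta \<iota> h X) = cheb (2 * n) (X_delta \<iota> h X) + 2)
     \<and>
     (n \<ge> 1 \<longrightarrow>
        X m * cheb n (X_delta \<iota> h X)
        = sc \<iota> (qh (- n)) * X (m - n) + sc \<iota> (qh n) * X (m + n)
          + (\<Sum>k=1..n. sc \<iota> ((\<Sum>l=1..k. qh (- (k + 1) + 2 * l)) * h)
                * cheb (n - k) (X_delta \<iota> h X)))
     \<and>
     (n \<ge> 2 \<longrightarrow>
        X m * X (m + n)
        = sc \<iota> (qh (2 * \<lfloor>real_of_int n / 2\<rfloor>))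
            * X \<lfloor>real_of_int m + real_of_int n / 2\<rfloor> * X \<lceil>real_of_int m + real_of_int n / 2\<rceil>
          + (\<Sum>k=1..n-1. sc \<iota> ((\<Sum>l=1..min k (n - k). qh (- 1 + 2 * l)) * h) * X (m + n - k))
          + (\<Sum>l=1..n-1. sc \<iota> (qh (- (n - 1 - l)) * coef_c h l)
                * cheb (n - 1 - l) (X_delta \<iota> h X)))"
proof -
  interpret kronecker_cluster "sc \<iota>" h X
    using assms(2,3) by (rule kronecker_cluster_sc)
  have \<delta>: "X_delta \<iota> h X = \<delta>"
    by (simp add: X_delta_def shifted_delta_def)
  have "X m * cheb n \<delta> = sc \<iota> (qh (- n)) * X (m - n) + sc \<iota> (qh n) * X (m + n)
      + (\<Sum>k=1..n. sc \<iota> ((\<Sum>l=1..k. qh (- (k + 1) + 2 * l)) * h) * cheb (n - k) \<delta>)"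
    if "n \<ge> 1"
    using X_mult_cheb_G[of n m] that by (simp add: cheb_G_def qint_def)
  moreover have "X m * X (m + n)
        = sc \<iota> (qh (2 * \<lfloor>real_of_int n / 2\<rfloor>))
            * X \<lfloor>real_of_int m + real_of_int n / 2\<rfloor> * X \<lceil>real_of_int m + real_of_int n / 2\<rceil>
          + (\<Sum>k=1..n-1. sc \<iota> ((\<Sum>l=1..min k (n - k). qh (- 1 + 2 * l)) * h) * X (m + n - k))
          + (\<Sum>l=1..n-1. sc \<iota> (qh (- (n - 1 - l)) * coef_c h l)
                * cheb (n - 1 - l) \<delta>)"
    if "n \<ge> 2"
  proof -
    have floor: "\<lfloor>real_of_int n / 2\<rfloor> = n div 2"
      using floor_divide_of_int_eq[of n 2] by simp
    have ceiling: "\<lceil>real_of_int n / 2\<rceil> = (n + 1) div 2"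
      by (cases "even n") (auto elim!: evenE oddE simp: add_divide_distrib ceiling_eq_iff)
    have "\<lfloor>real_of_int m + real_of_int n / 2\<rfloor> = m + n div 2"
      "\<lceil>real_of_int m + real_of_int n / 2\<rceil> = m + (n + 1) div 2"
      using floor ceiling ceiling_add_of_int[of "real_of_int n / 2" m]
      by (simp_all add: add.commute)
    \<comment> \<open>The substitution k = n - j swaps the two arguments of the minimum.\<close>
    moreover have "linear_part m n
        = (\<Sum>k=1..n-1. sc \<iota> ((\<Sum>l=1..min k (n - k). qh (- 1 + 2 * l)) * h) * X (m + n - k))"
      unfolding linear_part_def X_coef_def qodd_def
      by (rule sum.reindex_bij_witness[of _ "\<lambda>k. n - k" "\<lambda>k. n - k"])
        (auto simp: min.commute algebra_simps)
    ultimately show ?thesis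
      using X_mult_X[of n m] that by (simp only: floor leading_part_def delta_part_def)
  qed
  ultimately show ?thesis
    unfolding \<delta> using cheb_mult cheb_square by blast
qed

end
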